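(* Suppose $n$ is an odd integer with $t_1+t_2\leq n<t_3$, and put $K=k_1+k_2+k_3$, $N=\tfrac{n+1}{2}$. Then: (i) the $\mathfrak{BI}$-module $\mathscr M_n(x_1)\cap\mathscr M_n(x_2)$ is isomorphic to $W_1\oplus W_1$, where $W_1=E_{n-t_1-t_2}(k_2+k_3+N,\,-k_1-k_3-N,\,N)^{((-1,-1),(1\,2))}$; (ii) the $\mathfrak{BI}$-modules $\mathscr M_n(x_2)/(\mathscr M_n(x_1)\cap\mathscr M_n(x_2))$ and $\mathscr M_n/\mathscr M_n(x_1)$ are each isomorphic to $W_2\oplus W_2$, where $W_2=O_{t_1-1}(k_3,\,-K-n-1,\,k_2)^{(1\,2)}$; (iii) the $\mathfrak{BI}$-modules $\mathscr M_n(x_1)/(\mathscr M_n(x_1)\cap\mathscr M_n(x_2))$ and $\mathscr M_n/\mathscr M_n(x_2)$ are each isomorphic to $W_3\oplus W_3$, where $W_3=O_{t_2-1}(k_3,\,-K-n-1,\,k_1)$. Moreover, if $k_3\geq0$, then $W_1,W_2,W_3$ are irreducible, $W_1$ is isomorphic to $E_{n-t_1-t_2}(k_1+k_3+N,\,k_2+k_3+N,\,N)^{(-1,-1)}$ and $W_2$ is isomorphic to $O_{t_1-1}(-K-n-1,\,k_3,\,k_2)$.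
   Context: Fix real numbers $k_1,k_2,k_3$. For $i=1,2,3$ let $R_i$ be the operator on functions on $\mathbb R^3$ replacing $x_i$ by $-x_i$, and $T_if=\frac{\partial f}{\partial x_i}+k_i\frac{f-R_if}{x_i}$ (Dunkl operators). Let $\sigma_1=\begin{pmatrix}0&1\\1&0\end{pmatrix}$, $\sigma_2=\begin{pmatrix}0&-\sqrt{-1}\\ \sqrt{-1}&0\end{pmatrix}$, $\sigma_3=\begin{pmatrix}1&0\\0&-1\end{pmatrix}$, and let $e_i$ act on $\mathbb C^2$ by $\sigma_i$. Tensor products are over $\mathbb R$; $\mathbb R[\cdots]_m$ denotes homogeneous polynomials of degree $m$. Let $\mathbf D=e_1\otimes T_1+e_2\otimes T_2+e_3\otimes T_3$ and $\mathscr M_n=\ker(\mathbf D|_{\mathbb C^2\otimes\mathbb R[x_1,x_2,x_3]_n})$. For $i=1,2,3$ set $t_i=-2k_i$ if $2k_i$ is an odd negative integer, and $t_i=\infty$ otherwise. For $i=1,2,3$, $\mathscr M_n(x_i)=\mathscr M_n\cap\bigoplus_{j=t_i}^n\mathbb C^2\otimes(x_i^j\cdot\mathbb R[x_p,x_q]_{n-j})$ where $\{p,q\}=\{1,2,3\}\setminus\{i\}$ (it is $\{0\}$ if $n<t_i$); it is a $\mathfrak{BI}$-submodule of $\mathscr M_n$. $\mathfrak{BI}$ is the unital associative $\mathbb C$-algebra generated by $X,Y,Z$ with relations saying that $\{X,Y\}-Z$, $\{Y,Z\}-X$, $\{Z,X\}-Y$ commute with $X,Y,Z$ ($\{A,B\}=AB+BA$).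 $\mathscr M_n$ is a $\mathfrak{BI}$-module via $X=(\sqrt{-1}\,e_1\otimes(x_3T_2-x_2T_3)+\tfrac12)R_2R_3+k_2R_3+k_3R_2$, $Y=(\sqrt{-1}\,e_2\otimes(x_1T_3-x_3T_1)+\tfrac12)R_1R_3+k_3R_1+k_1R_3$, $Z=(\sqrt{-1}\,e_3\otimes(x_2T_1-x_1T_2)+\tfrac12)R_1R_2+k_1R_2+k_2R_1$, operators composed right to left, $R_i$ acting on the polynomial factor. Twisting: for a $\mathfrak{BI}$-module $V$ and algebra automorphism $\varepsilon$, $V^\varepsilon$ is $V$ with action $x\cdot v=\varepsilon(x)v$. A permutation $\sigma\in\mathfrak S_3$ denotes the automorphism sending the generator with index $i$ in $(X,Y,Z)$ to the generator with index $\sigma(i)$ (e.g. $(1\,2)$ swaps $X,Y$ and fixes $Z$); the sign automorphisms are $(1,-1)\colon X\mapsto X,Y\mapsto -Y,Z\mapsto -Z$; $(-1,1)\colon X\mapsto -X,Y\mapsto Y,Z\mapsto -Z$; $(-1,-1)\colon X\mapsto -X,Y\mapsto -Y,Z\mapsto Z$; a pair $(\epsilon,\sigma)$ denotes the composite $\epsilon\circ\sigma$. For $a,b,c\in\mathbb C$ and an integer $d\geq0$, let $\theta_i=\frac{(-1)^i(2a-d+2i)}{2}$, $\theta^*_i=\frac{(-1)^i(2b-d+2i)}{2}$ ($0\le i\le d$). For odd $d$, $E_d(a,b,c)$ is the $\mathfrak{BI}$-module $\mathbb C^{d+1}$ in which, w.r.t. a basis $v_0,\dots,v_d$, $X$ acts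 by the lower bidiagonal matrix with diagonal $(\theta_i)$ and subdiagonal entries $1$, $Y$ by the upper bidiagonal matrix with diagonal $(\theta^*_i)$ and superdiagonal $(\varphi_1,\dots,\varphi_d)$ with $\varphi_i=i(d-i+1)$ ($i$ even), $\varphi_i=c^2-\frac{(2a+2b-d+2i-1)^2}{4}$ ($i$ odd), and $Z=\{X,Y\}-\big(c^2-a^2-b^2+\frac{(d+1)^2}{4}\big)$. For even $d$, $O_d(a,b,c)$ is defined in the same way but with $\varphi_i=\frac{i(d+1-2i-2a-2b-2c)}{2}$ ($i$ even), $\varphi_i=\frac{(i-d-1)(d+1-2i-2a-2b+2c)}{2}$ ($i$ odd), and $Z=\{X,Y\}-(2ab-c(d+1))$. *)

theory Defs
  imports Complex_Main "HOL-Library.Function_Algebras" "HOL-Library.Extended_Nat"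
begin

text \<open>All complex vector spaces are realised as spaces of functions 'i => complex
  with pointwise operations; sc c f is the scalar multiple.\<close>

definition sc :: "complex \<Rightarrow> ('i \<Rightarrow> complex) \<Rightarrow> ('i \<Rightarrow> complex)" where
  "sc c f = (\<lambda>x. c * f x)"

type_synonym mi = "nat \<times> nat \<times> nat"
text \<open>An element of C^2 (x) R[x1,x2,x3] is a finitely supported coefficient function
  (monomial exponent, spinor component) => complex; component False is the first
  coordinate of C^2, True the second.\<close>
type_synonym spoly = "mi \<times> bool \<Rightarrow> complex"

definition comp :: "nat \<Rightarrow> mi \<Rightarrow> nat" where
  "comp i \<alpha> = (case \<alpha> of (a,b,c) \<Rightarrow> if i = 1 then a else if i = 2 then b else c)"

definition addi :: "nat \<Rightarrow> mi \<Rightarrow> mi" where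
  "addi i \<alpha> = (case \<alpha> of (a,b,c) \<Rightarrow>
     if i = 1 then (a+1,b,c) else if i = 2 then (a,b+1,c) else (a,b,c+1))"

definition subi :: "nat \<Rightarrow> mi \<Rightarrow> mi" where
  "subi i \<alpha> = (case \<alpha> of (a,b,c) \<Rightarrow>
     if i = 1 then (a-1,b,c) else if i = 2 then (a,b-1,c) else (a,b,c-1))"

definition deg :: "mi \<Rightarrow> nat" where
  "deg \<alpha> = (case \<alpha> of (a,b,c) \<Rightarrow> a+b+c)"

definition Pn :: "nat \<Rightarrow> spoly set" where
  "Pn n = {f. \<forall>\<alpha> s. f (\<alpha>,s) \<noteq> 0 \<longrightarrow> deg \<alpha> = n}"

text \<open>Reflection R_i, partial derivative, multiplication by x_i, and the
  (exact) division by x_i applied to polynomials divisible by x_i.\<close>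
definition refl :: "nat \<Rightarrow> spoly \<Rightarrow> spoly" where
  "refl i f = (\<lambda>(\<alpha>,s). (-1) ^ comp i \<alpha> * f (\<alpha>,s))"

definition dpart :: "nat \<Rightarrow> spoly \<Rightarrow> spoly" where
  "dpart i f = (\<lambda>(\<alpha>,s). of_nat (comp i \<alpha> + 1) * f (addi i \<alpha>, s))"

definition divx :: "nat \<Rightarrow> spoly \<Rightarrow> spoly" where
  "divx i f = (\<lambda>(\<alpha>,s). f (addi i \<alpha>, s))"

definition mulx :: "nat \<Rightarrow> spoly \<Rightarrow> spoly" where
  "mulx i f = (\<lambda>(\<alpha>,s). if 0 < comp i \<alpha> then f (subi i \<alpha>, s) else 0)"

definition kk :: "real \<Rightarrow> real \<Rightarrow> real \<Rightarrow> nat \<Rightarrow> real" where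
  "kk k1 k2 k3 i = (if i = 1 then k1 else if i = 2 then k2 else k3)"

definition dunkl :: "real \<Rightarrow> real \<Rightarrow> real \<Rightarrow> nat \<Rightarrow> spoly \<Rightarrow> spoly" where
  "dunkl k1 k2 k3 i f = dpart i f + sc (complex_of_real (kk k1 k2 k3 i)) (divx i (f - refl i f))"

text \<open>Pauli matrices acting on the C^2 factor (e_i acts by sigma_i).\<close>
definition sig :: "nat \<Rightarrow> spoly \<Rightarrow> spoly" where
  "sig i f = (\<lambda>(\<alpha>,s).
     if i = 1 then f (\<alpha>, \<not> s)
     else if i = 2 then (if s then \<i> * f (\<alpha>, False) else - \<i> * f (\<alpha>, True))
     else (if s then - f (\<alpha>, True) else f (\<alpha>, False)))"

definition dirac :: "real \<Rightarrow> real \<Rightarrow> real \<Rightarrow> spoly \<Rightarrow> spoly" where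
  "dirac k1 k2 k3 f = sig 1 (dunkl k1 k2 k3 1 f) + sig 2 (dunkl k1 k2 k3 2 f)
                      + sig 3 (dunkl k1 k2 k3 3 f)"

definition Mn :: "real \<Rightarrow> real \<Rightarrow> real \<Rightarrow> nat \<Rightarrow> spoly set" where
  "Mn k1 k2 k3 n = {f \<in> Pn n. dirac k1 k2 k3 f = 0}"

definition tval :: "real \<Rightarrow> enat" where
  "tval k = (if \<exists>m::nat. odd m \<and> 2 * k = - real m then enat (nat \<lfloor>- 2 * k\<rfloor>) else \<infinity>)"

definition Mnx :: "real \<Rightarrow> real \<Rightarrow> real \<Rightarrow> nat \<Rightarrow> nat \<Rightarrow> spoly set" where
  "Mnx k1 k2 k3 i n = {f \<in> Mn k1 k2 k3 n.
      \<forall>\<alpha> s. f (\<alpha>,s) \<noteq> 0 \<longrightarrow> tval (kk k1 k2 k3 i) \<le> enat (comp i \<alpha>)}"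

text \<open>The BI action: generator 1 = X, 2 = Y, 3 = Z.\<close>
definition biact :: "real \<Rightarrow> real \<Rightarrow> real \<Rightarrow> nat \<Rightarrow> spoly \<Rightarrow> spoly" where
  "biact k1 k2 k3 j f =
    (let T = dunkl k1 k2 k3 in
     if j = 1 then
       (let g = refl 2 (refl 3 f) in
        sc \<i> (sig 1 (mulx 3 (T 2 g) - mulx 2 (T 3 g))) + sc (1/2) g)
       + sc (complex_of_real k2) (refl 3 f) + sc (complex_of_real k3) (refl 2 f)
     else if j = 2 then
       (let g = refl 1 (refl 3 f) in
        sc \<i> (sig 2 (mulx 1 (T 3 g) - mulx 3 (T 1 g))) + sc (1/2) g)
       + sc (complex_of_real k3) (refl 1 f) + sc (complex_of_real k1) (refl 3 f)
     else
       (let g = refl 1 (refl 2 f) in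
        sc \<i> (sig 3 (mulx 2 (T 1 g) - mulx 1 (T 2 g))) + sc (1/2) g)
       + sc (complex_of_real k1) (refl 2 f) + sc (complex_of_real k2) (refl 1 f))"

section \<open>BI-modules given by a carrier and the action of the generators 1,2,3 = X,Y,Z\<close>

definition lin_on :: "('i \<Rightarrow> complex) set \<Rightarrow> (('i \<Rightarrow> complex) \<Rightarrow> ('j \<Rightarrow> complex)) \<Rightarrow> bool" where
  "lin_on V \<phi> = (\<forall>u\<in>V. \<forall>v\<in>V. \<forall>c. \<phi> (sc c u + v) = sc c (\<phi> u) + \<phi> v)"

text \<open>Isomorphism of BI-modules (V,A) and (W,B): a linear bijection intertwining
  the generators X,Y,Z (hence the whole algebra).\<close>
definition bi_iso :: "('i \<Rightarrow> complex) set \<Rightarrow> (nat \<Rightarrow> ('i \<Rightarrow> complex) \<Rightarrow> ('i \<Rightarrow> complex))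
   \<Rightarrow> ('j \<Rightarrow> complex) set \<Rightarrow> (nat \<Rightarrow> ('j \<Rightarrow> complex) \<Rightarrow> ('j \<Rightarrow> complex)) \<Rightarrow> bool" where
  "bi_iso V A W B = (\<exists>\<phi>. lin_on V \<phi> \<and> bij_betw \<phi> V W \<and>
      (\<forall>i\<in>{1,2,3}. \<forall>v\<in>V. \<phi> (A i v) = B i (\<phi> v)))"

text \<open>V/U is isomorphic to (W,B) as BI-modules: realised (first isomorphism theorem)
  as a surjective linear intertwiner V -> W with kernel exactly U.\<close>
definition bi_quot_iso :: "('i \<Rightarrow> complex) set \<Rightarrow> ('i \<Rightarrow> complex) set
   \<Rightarrow> (nat \<Rightarrow> ('i \<Rightarrow> complex) \<Rightarrow> ('i \<Rightarrow> complex))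
   \<Rightarrow> ('j \<Rightarrow> complex) set \<Rightarrow> (nat \<Rightarrow> ('j \<Rightarrow> complex) \<Rightarrow> ('j \<Rightarrow> complex)) \<Rightarrow> bool" where
  "bi_quot_iso V U A W B = (\<exists>\<phi>. lin_on V \<phi> \<and> \<phi> ` V = W \<and> {v\<in>V. \<phi> v = 0} = U \<and>
      (\<forall>i\<in>{1,2,3}. \<forall>v\<in>V. \<phi> (A i v) = B i (\<phi> v)))"

definition bi_irred :: "('i \<Rightarrow> complex) set \<Rightarrow> (nat \<Rightarrow> ('i \<Rightarrow> complex) \<Rightarrow> ('i \<Rightarrow> complex)) \<Rightarrow> bool" where
  "bi_irred V A = (V \<noteq> {0} \<and>
     (\<forall>U. U \<subseteq> V \<and> 0 \<in> U \<and> (\<forall>u\<in>U. \<forall>v\<in>U. \<forall>c. sc c u + v \<in> U)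
          \<and> (\<forall>i\<in>{1,2,3}. \<forall>u\<in>U. A i u \<in> U) \<longrightarrow> U = {0} \<or> U = V))"

definition twist :: "(nat \<Rightarrow> complex) \<Rightarrow> (nat \<Rightarrow> nat) \<Rightarrow> (nat \<Rightarrow> ('i \<Rightarrow> complex) \<Rightarrow> ('i \<Rightarrow> complex))
   \<Rightarrow> nat \<Rightarrow> ('i \<Rightarrow> complex) \<Rightarrow> ('i \<Rightarrow> complex)" where
  "twist s \<sigma> A = (\<lambda>i v. sc (s (\<sigma> i)) (A (\<sigma> i) v))"

definition sw12 :: "nat \<Rightarrow> nat" where
  "sw12 i = (if i = 1 then 2 else if i = 2 then 1 else i)"

definition sgn_mm :: "nat \<Rightarrow> complex" where
  "sgn_mm i = (if i = 3 then 1 else -1)"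

definition dsum2_car :: "(nat \<Rightarrow> complex) set \<Rightarrow> (bool \<times> nat \<Rightarrow> complex) set" where
  "dsum2_car V = {w. \<forall>b. (\<lambda>j. w (b,j)) \<in> V}"

definition dsum2 :: "(nat \<Rightarrow> (nat \<Rightarrow> complex) \<Rightarrow> (nat \<Rightarrow> complex))
    \<Rightarrow> nat \<Rightarrow> (bool \<times> nat \<Rightarrow> complex) \<Rightarrow> (bool \<times> nat \<Rightarrow> complex)" where
  "dsum2 A = (\<lambda>i w (b,j). A i (\<lambda>j'. w (b,j')) j)"

section \<open>The modules E_d and O_d on C^{d+1} (coordinates w.r.t. v_0..v_d)\<close>

definition Cd :: "nat \<Rightarrow> (nat \<Rightarrow> complex) set" where
  "Cd d = {v. \<forall>i>d. v i = 0}"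

definition LX :: "nat \<Rightarrow> (nat \<Rightarrow> complex) \<Rightarrow> (nat \<Rightarrow> complex) \<Rightarrow> (nat \<Rightarrow> complex)" where
  "LX d \<theta> v = (\<lambda>i. if i \<le> d then \<theta> i * v i + (if 0 < i then v (i-1) else 0) else 0)"

definition LY :: "nat \<Rightarrow> (nat \<Rightarrow> complex) \<Rightarrow> (nat \<Rightarrow> complex) \<Rightarrow> (nat \<Rightarrow> complex) \<Rightarrow> (nat \<Rightarrow> complex)" where
  "LY d \<theta>s \<phi> v = (\<lambda>i. if i \<le> d then \<theta>s i * v i + (if i < d then \<phi> (i+1) * v (i+1) else 0) else 0)"

definition bimat :: "nat \<Rightarrow> (nat \<Rightarrow> complex) \<Rightarrow> (nat \<Rightarrow> complex) \<Rightarrow> (nat \<Rightarrow> complex) \<Rightarrow> complex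
    \<Rightarrow> nat \<Rightarrow> (nat \<Rightarrow> complex) \<Rightarrow> (nat \<Rightarrow> complex)" where
  "bimat d \<theta> \<theta>s \<phi> c0 j v =
    (if j = 1 then LX d \<theta> v else if j = 2 then LY d \<theta>s \<phi> v
     else LX d \<theta> (LY d \<theta>s \<phi> v) + LY d \<theta>s \<phi> (LX d \<theta> v) - sc c0 v)"

definition thetas :: "nat \<Rightarrow> complex \<Rightarrow> nat \<Rightarrow> complex" where
  "thetas d a i = (-1) ^ i * (2 * a - of_nat d + 2 * of_nat i) / 2"

definition Emod :: "nat \<Rightarrow> complex \<Rightarrow> complex \<Rightarrow> complex \<Rightarrow> nat \<Rightarrow> (nat \<Rightarrow> complex) \<Rightarrow> (nat \<Rightarrow> complex)" where
  "Emod d a b c = bimat d (thetas d a) (thetas d b)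
     (\<lambda>i. if even i then of_nat i * (of_nat d - of_nat i + 1)
          else c^2 - (2*a + 2*b - of_nat d + 2 * of_nat i - 1)^2 / 4)
     (c^2 - a^2 - b^2 + (of_nat d + 1)^2 / 4)"

definition Omod :: "nat \<Rightarrow> complex \<Rightarrow> complex \<Rightarrow> complex \<Rightarrow> nat \<Rightarrow> (nat \<Rightarrow> complex) \<Rightarrow> (nat \<Rightarrow> complex)" where
  "Omod d a b c = bimat d (thetas d a) (thetas d b)
     (\<lambda>i. if even i then of_nat i * (of_nat d + 1 - 2 * of_nat i - 2*a - 2*b - 2*c) / 2
          else (of_nat i - of_nat d - 1) * (of_nat d + 1 - 2 * of_nat i - 2*a - 2*b + 2*c) / 2)
     (2*a*b - c * (of_nat d + 1))"


definition tnat :: "real \<Rightarrow> nat" where "tnat k = the_enat (tval k)"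

definition Ncst :: "nat \<Rightarrow> complex" where "Ncst n = (of_nat n + 1) / 2"

definition W1 :: "real \<Rightarrow> real \<Rightarrow> real \<Rightarrow> nat \<Rightarrow> nat \<Rightarrow> (nat \<Rightarrow> complex) \<Rightarrow> (nat \<Rightarrow> complex)" where
  "W1 k1 k2 k3 n = twist sgn_mm sw12
     (Emod (n - tnat k1 - tnat k2) (of_real k2 + of_real k3 + Ncst n)
        (- of_real k1 - of_real k3 - Ncst n) (Ncst n))"

definition W2 :: "real \<Rightarrow> real \<Rightarrow> real \<Rightarrow> nat \<Rightarrow> nat \<Rightarrow> (nat \<Rightarrow> complex) \<Rightarrow> (nat \<Rightarrow> complex)" where
  "W2 k1 k2 k3 n = twist (\<lambda>_. 1) sw12
     (Omod (tnat k1 - 1) (of_real k3) (- of_real (k1 + k2 + k3) - of_nat n - 1) (of_real k2))"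

definition W3 :: "real \<Rightarrow> real \<Rightarrow> real \<Rightarrow> nat \<Rightarrow> nat \<Rightarrow> (nat \<Rightarrow> complex) \<Rightarrow> (nat \<Rightarrow> complex)" where
  "W3 k1 k2 k3 n =
     Omod (tnat k2 - 1) (of_real k3) (- of_real (k1 + k2 + k3) - of_nat n - 1) (of_real k1)"

end

theory Submission
  imports Defs
begin

text \<open>Since \<open>n < t\<^sub>3\<close>, the Dunkl operator \<open>T\<^sub>3\<close> is injective on \<open>x\<^sub>3, \<dots>, x\<^sub>3\<^sup>n\<close>, so an element of \<open>M\<^sub>n\<close> is
  determined by an arbitrary restriction to \<open>x\<^sub>3 = 0\<close> (Cauchy-Kovalevskaya extension). On the monomials
  \<open>x\<^sub>1\<^sup>a x\<^sub>2\<^sup>b\<close> with \<open>a + b = n\<close>, and for each spinor component, \<open>X\<close> and \<open>Y\<close> are bidiagonal in opposite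
  directions; the off-diagonal entries vanish exactly at \<open>a = t\<^sub>1\<close> and \<open>b = t\<^sub>2\<close>. The submodules and quotients
  are therefore the windows \<open>a < t\<^sub>1\<close>, \<open>b < t\<^sub>2\<close> and \<open>a \<ge> t\<^sub>1, b \<ge> t\<^sub>2\<close>, and rescaling the monomials gives
  the modules \<open>E\<^sub>d\<close> and \<open>O\<^sub>d\<close>.

  For the last part, the cubic form of the defining relations of the Bannai-Ito algebra shows that a
  bidiagonal module maps to any module with the same central values that contains a suitable eigenvector.
  Playing two bidiagonal presentations with nonzero \<open>\<phi>\<^sub>i\<close> against each other gives irreducibility, and
  then the isomorphisms.\<close>

section \<open>The cubic relations of bidiagonal modules\<close>

text \<open>The obstacle in the last part is to climb from an eigenvector of X in an arbitrary
  submodule to the standard basis vectors. The product of d shifted copies of Y, with the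
  eigenvalues taken from the top downwards, sends every vector into the line of v_0, so only its
  nonvanishing is in doubt. A second presentation in which these eigenvalues appear in reversed
  order, with nonzero entries, settles that. For odd d it is again an E_d, because reversing
  \<open>thetas d b\<close> gives \<open>thetas d (- b)\<close> and the central values of E_d
  contain only squares of the parameters. For even d reversal needs a sign twist of an O_d, and the
  exchange of X and Y needs yet another presentation. The condition k_3 \<ge> 0 enters twice: it
  keeps factors such as 2 k_3 + h in the second presentation nonzero, and it separates the
  eigenvalues of one generator from each other and from 1 - \<theta>_0.\<close>

text \<open>The untruncated operators: once \<open>\<phi> (d + 1) = 0\<close>, the truncations in \<open>LX\<close> and \<open>LY\<close>
  are invisible below degree \<open>d\<close>.\<close>

definition lx :: "(nat \<Rightarrow> complex) \<Rightarrow> (nat \<Rightarrow> complex) \<Rightarrow> nat \<Rightarrow> complex" where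
  "lx \<theta> v i = \<theta> i * v i + (case i of 0 \<Rightarrow> 0 | Suc j \<Rightarrow> v j)"

definition ly :: "(nat \<Rightarrow> complex) \<Rightarrow> (nat \<Rightarrow> complex) \<Rightarrow> (nat \<Rightarrow> complex) \<Rightarrow> nat \<Rightarrow> complex" where
  "ly s \<phi> v i = s i * v i + \<phi> (Suc i) * v (Suc i)"

text \<open>Eliminating \<open>Z = {X,Y} - \<kappa>\<close> from \<open>{Z,X} - Y = \<mu>\<close> gives the cubic relation
  \<open>X\<^sup>2Y + 2XYX + YX\<^sup>2 - Y = 2\<kappa>X + \<mu>\<close>, and likewise with \<open>X\<close>, \<open>Y\<close> exchanged.\<close>

definition bi_rel :: "nat \<Rightarrow> ((nat \<Rightarrow> complex) \<Rightarrow> nat \<Rightarrow> complex) \<Rightarrow> ((nat \<Rightarrow> complex) \<Rightarrow> nat \<Rightarrow> complex)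
    \<Rightarrow> complex \<Rightarrow> complex \<Rightarrow> bool" where
  "bi_rel d A B \<kappa> \<mu> \<longleftrightarrow> (\<forall>v\<in>Cd d. \<forall>i.
     A (A (B v)) i + 2 * A (B (A v)) i + B (A (A v)) i - B v i = 2 * \<kappa> * A v i + \<mu> * v i)"

lemma LX_eq: "i \<le> d \<Longrightarrow> (\<And>j. j \<le> d \<Longrightarrow> v j = w j) \<Longrightarrow> LX d \<theta> v i = lx \<theta> w i"
  by (cases i) (auto simp: LX_def lx_def)

lemma LY_eq: "i \<le> d \<Longrightarrow> \<phi> (Suc d) = 0 \<Longrightarrow> (\<And>j. j \<le> d \<Longrightarrow> v j = w j) \<Longrightarrow> LY d s \<phi> v i = ly s \<phi> w i"
  by (cases "i = d") (auto simp: LY_def ly_def)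

lemma LX_Cd [simp]: "LX d \<theta> v \<in> Cd d" by (auto simp: LX_def Cd_def)
lemma LY_Cd [simp]: "LY d s \<phi> v \<in> Cd d" by (auto simp: LY_def Cd_def)

text \<open>The left side is a matrix with four diagonals, from one above to two below the main one,
  and the hypotheses compare them with 2 \<kappa> X + \<mu>: \<open>th\<close> kills the
  superdiagonal, \<open>s\<close> the second subdiagonal, \<open>C\<close> and \<open>D\<close>
  treat the two diagonals of X. Row 0 has no predecessor, hence \<open>D0\<close>.\<close>

lemma bi_rel_XY:
  assumes "\<phi> 0 = 0" "\<phi> (Suc d) = 0"
    and th: "\<And>i. (\<theta> i + \<theta> (Suc i))^2 = 1"
    and s: "\<And>i. s i + 2 * s (Suc i) + s (Suc (Suc i)) = 0"
    and D0: "4 * s 0 * \<theta> 0 ^ 2 + \<phi> 1 * (\<theta> 0 + \<theta> 1) + 2 * \<theta> 0 * \<phi> 1 - s 0 = 2 * \<kappa> * \<theta> 0 + \<mu>"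
    and D: "\<And>i. 4 * s (Suc i) * \<theta> (Suc i) ^ 2 + \<phi> (Suc (Suc i)) * (\<theta> (Suc i) + \<theta> (Suc (Suc i)))
       + 2 * \<theta> (Suc i) * (\<phi> (Suc i) + \<phi> (Suc (Suc i))) + \<phi> (Suc i) * (\<theta> i + \<theta> (Suc i)) - s (Suc i)
       = 2 * \<kappa> * \<theta> (Suc i) + \<mu>"
    and C: "\<And>i. (s i + s (Suc i)) * (\<theta> i + \<theta> (Suc i)) + \<phi> (Suc (Suc i)) + 2 * \<phi> (Suc i) + \<phi> i
       + 2 * (s i * \<theta> i + s (Suc i) * \<theta> (Suc i)) = 2 * \<kappa>"
  shows "bi_rel d (LX d \<theta>) (LY d s \<phi>) \<kappa> \<mu>"
  unfolding bi_rel_def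
proof (intro ballI allI)
  fix v i assume v: "v \<in> Cd d"
  let ?X = "LX d \<theta>" and ?Y = "LY d s \<phi>" and ?x = "lx \<theta>" and ?y = "ly s \<phi>"
  show "?X (?X (?Y v)) i + 2 * ?X (?Y (?X v)) i + ?Y (?X (?X v)) i - ?Y v i = 2 * \<kappa> * ?X v i + \<mu> * v i"
  proof (cases "i \<le> d")
    case False
    then show ?thesis using v by (simp add: LX_def LY_def Cd_def)
  next
    case True
    have "?x (?x (?y v)) i + 2 * ?x (?y (?x v)) i + ?y (?x (?x v)) i - ?y v i = 2 * \<kappa> * ?x v i + \<mu> * v i"
    proof (cases i)
      case 0
      have e: "?x (?x (?y v)) i + 2 * ?x (?y (?x v)) i + ?y (?x (?x v)) i - ?y v i
        = v 0 * (4 * s 0 * \<theta> 0 ^ 2 + \<phi> 1 * (\<theta> 0 + \<theta> 1) + 2 * \<theta> 0 * \<phi> 1 - s 0)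
        + v 1 * \<phi> 1 * ((\<theta> 0 + \<theta> 1)^2 - 1)"
        unfolding 0 by (simp add: lx_def ly_def) algebra
      show ?thesis unfolding e D0 using th[of 0] by (simp add: 0 lx_def algebra_simps)
    next
      case (Suc j)
      have e: "?x (?x (?y v)) i + 2 * ?x (?y (?x v)) i + ?y (?x (?x v)) i - ?y v i
        = v (Suc j) * (4 * s (Suc j) * \<theta> (Suc j) ^ 2 + \<phi> (Suc (Suc j)) * (\<theta> (Suc j) + \<theta> (Suc (Suc j)))
       + 2 * \<theta> (Suc j) * (\<phi> (Suc j) + \<phi> (Suc (Suc j))) + \<phi> (Suc j) * (\<theta> j + \<theta> (Suc j)) - s (Suc j))
        + v (Suc (Suc j)) * \<phi> (Suc (Suc j)) * ((\<theta> (Suc j) + \<theta> (Suc (Suc j)))^2 - 1)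
        + v j * ((s j + s (Suc j)) * (\<theta> j + \<theta> (Suc j)) + \<phi> (Suc (Suc j)) + 2 * \<phi> (Suc j) + \<phi> j
       + 2 * (s j * \<theta> j + s (Suc j) * \<theta> (Suc j)))
        + (case j of 0 \<Rightarrow> 0 | Suc m \<Rightarrow> v m * (s m + 2 * s (Suc m) + s (Suc (Suc m))))"
        unfolding Suc using assms(1) by (cases j) (simp_all add: lx_def ly_def algebra_simps power2_eq_square)
      show ?thesis unfolding e C D using th[of "Suc j"] s
        by (simp add: Suc lx_def algebra_simps split: nat.split)
    qed
    then show ?thesis using True assms(2) by (simp add: LX_eq LY_eq)
  qed
qed

text \<open>Now the band reaches two places above the diagonal, where the entries carry factors
  \<phi>. After removing such a factor the superdiagonal gives the same condition \<open>C\<close>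
  as before.\<close>

lemma bi_rel_YX:
  assumes "\<phi> 0 = 0" "\<phi> (Suc d) = 0"
    and s: "\<And>i. (s i + s (Suc i))^2 = 1"
    and th: "\<And>i. \<theta> i + 2 * \<theta> (Suc i) + \<theta> (Suc (Suc i)) = 0"
    and D0: "4 * \<theta> 0 * s 0 ^ 2 + \<phi> 1 * (s 0 + s 1) + 2 * s 0 * \<phi> 1 - \<theta> 0 = 2 * \<kappa> * s 0 + \<mu>"
    and D: "\<And>i. 4 * \<theta> (Suc i) * s (Suc i) ^ 2 + \<phi> (Suc (Suc i)) * (s (Suc i) + s (Suc (Suc i)))
       + 2 * s (Suc i) * (\<phi> (Suc i) + \<phi> (Suc (Suc i))) + \<phi> (Suc i) * (s i + s (Suc i)) - \<theta> (Suc i)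
       = 2 * \<kappa> * s (Suc i) + \<mu>"
    and C: "\<And>i. (s i + s (Suc i)) * (\<theta> i + \<theta> (Suc i)) + \<phi> (Suc (Suc i)) + 2 * \<phi> (Suc i) + \<phi> i
       + 2 * (s i * \<theta> i + s (Suc i) * \<theta> (Suc i)) = 2 * \<kappa>"
  shows "bi_rel d (LY d s \<phi>) (LX d \<theta>) \<kappa> \<mu>"
  unfolding bi_rel_def
proof (intro ballI allI)
  fix v i assume v: "v \<in> Cd d"
  let ?X = "LX d \<theta>" and ?Y = "LY d s \<phi>" and ?x = "lx \<theta>" and ?y = "ly s \<phi>"
  show "?Y (?Y (?X v)) i + 2 * ?Y (?X (?Y v)) i + ?X (?Y (?Y v)) i - ?X v i = 2 * \<kappa> * ?Y v i + \<mu> * v i"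
  proof (cases "i \<le> d")
    case False
    then show ?thesis using v by (simp add: LX_def LY_def Cd_def)
  next
    case True
    have "?y (?y (?x v)) i + 2 * ?y (?x (?y v)) i + ?x (?y (?y v)) i - ?x v i = 2 * \<kappa> * ?y v i + \<mu> * v i"
    proof (cases i)
      case 0
      have e: "?y (?y (?x v)) i + 2 * ?y (?x (?y v)) i + ?x (?y (?y v)) i - ?x v i
        = v 0 * (4 * \<theta> 0 * s 0 ^ 2 + \<phi> 1 * (s 0 + s 1) + 2 * s 0 * \<phi> 1 - \<theta> 0)
        + v 1 * \<phi> 1 * ((s 0 + s 1) * (\<theta> 0 + \<theta> 1) + \<phi> 2 + 2 * \<phi> 1 + \<phi> 0
       + 2 * (s 0 * \<theta> 0 + s 1 * \<theta> 1))
        + v 2 * \<phi> 1 * \<phi> 2 * (\<theta> 0 + 2 * \<theta> 1 + \<theta> 2)"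
        unfolding 0 using assms(1) by (simp add: lx_def ly_def numeral_2_eq_2 algebra_simps)
      show ?thesis unfolding e D0 using th[of 0] C[of 0] by (simp add: 0 ly_def numeral_2_eq_2 algebra_simps)
    next
      case (Suc j)
      have e: "?y (?y (?x v)) i + 2 * ?y (?x (?y v)) i + ?x (?y (?y v)) i - ?x v i
        = v (Suc j) * (4 * \<theta> (Suc j) * s (Suc j) ^ 2 + \<phi> (Suc (Suc j)) * (s (Suc j) + s (Suc (Suc j)))
       + 2 * s (Suc j) * (\<phi> (Suc j) + \<phi> (Suc (Suc j))) + \<phi> (Suc j) * (s j + s (Suc j)) - \<theta> (Suc j))
        + v (Suc (Suc j)) * \<phi> (Suc (Suc j)) * ((s (Suc j) + s (Suc (Suc j))) * (\<theta> (Suc j) + \<theta> (Suc (Suc j)))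
        + \<phi> (Suc (Suc (Suc j))) + 2 * \<phi> (Suc (Suc j)) + \<phi> (Suc j)
       + 2 * (s (Suc j) * \<theta> (Suc j) + s (Suc (Suc j)) * \<theta> (Suc (Suc j))))
        + v j * ((s j + s (Suc j))^2 - 1)
        + v (Suc (Suc (Suc j))) * \<phi> (Suc (Suc j)) * \<phi> (Suc (Suc (Suc j))) * 
           (\<theta> (Suc j) + 2 * \<theta> (Suc (Suc j)) + \<theta> (Suc (Suc (Suc j))))"
        unfolding Suc by (simp add: lx_def ly_def) algebra
      show ?thesis unfolding e C D using s th
        by (simp add: Suc ly_def algebra_simps)
    qed
    then show ?thesis using True assms(2) by (simp add: LX_eq LY_eq)
  qed
qed

section \<open>Central values of E_d, O_d and the reversed O_d\<close>

definition Ephi :: "nat \<Rightarrow> complex \<Rightarrow> complex \<Rightarrow> complex \<Rightarrow> nat \<Rightarrow> complex" where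
  "Ephi d a b c i = (if even i then of_nat i * (of_nat d - of_nat i + 1)
          else c^2 - (2*a + 2*b - of_nat d + 2 * of_nat i - 1)^2 / 4)"

definition Ophi :: "nat \<Rightarrow> complex \<Rightarrow> complex \<Rightarrow> complex \<Rightarrow> nat \<Rightarrow> complex" where
  "Ophi d a b c i = (if even i then of_nat i * (of_nat d + 1 - 2 * of_nat i - 2*a - 2*b - 2*c) / 2
          else (of_nat i - of_nat d - 1) * (of_nat d + 1 - 2 * of_nat i - 2*a - 2*b + 2*c) / 2)"

text \<open>The scalar {X,Y} - Z on E_d. The scalars {Z,X} - Y and {Y,Z} - X have the same shape
  with permuted parameters, so below they appear as \<open>Ecst d a c b\<close> and
  \<open>Ecst d b c a\<close>; likewise for O_d.\<close>

definition Ecst :: "nat \<Rightarrow> complex \<Rightarrow> complex \<Rightarrow> complex \<Rightarrow> complex" where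
  "Ecst d a b c = c^2 - a^2 - b^2 + (of_nat d + 1)^2 / 4"

definition Ocst :: "nat \<Rightarrow> complex \<Rightarrow> complex \<Rightarrow> complex \<Rightarrow> complex" where
  "Ocst d a b c = 2*a*b - c * (of_nat d + 1)"

lemma Emod_eq: "Emod d a b c = bimat d (thetas d a) (thetas d b) (Ephi d a b c) (Ecst d a b c)"
  by (simp add: Emod_def Ephi_def[abs_def] Ecst_def)

lemma Omod_eq: "Omod d a b c = bimat d (thetas d a) (thetas d b) (Ophi d a b c) (Ocst d a b c)"
  by (simp add: Omod_def Ophi_def[abs_def] Ocst_def)

text \<open>Consecutive eigenvalues add up to a sign; both conditions on eigenvalue sequences in the
  cubic relations follow from this.\<close>

lemma thetas_Suc: "thetas d a (Suc i) = - ((-1) ^ i) - thetas d a i"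
  by (simp add: thetas_def field_simps)

lemma m1_sq: "((-1::complex) ^ i)\<^sup>2 = 1"
  by (simp add: power2_eq_square flip: power_mult_distrib)

lemma thetas_sq: "(thetas d a i + thetas d a (Suc i))\<^sup>2 = 1"
  by (simp add: thetas_Suc m1_sq)

lemma thetas_sum3: "thetas d a i + 2 * thetas d a (Suc i) + thetas d a (Suc (Suc i)) = 0"
  by (simp add: thetas_Suc)

lemma E_rel_XY:
  assumes "odd d"
  shows "bi_rel d (LX d (thetas d a)) (LY d (thetas d b) (Ephi d a b c)) (Ecst d a b c) (Ecst d a c b)"
proof (rule bi_rel_XY)
  show "Ephi d a b c (Suc d) = 0" using assms by (simp add: Ephi_def)
  fix i
  show "4 * thetas d b (Suc i) * thetas d a (Suc i) ^ 2 + Ephi d a b c (Suc (Suc i)) * (thetas d a (Suc i) + thetas d a (Suc (Suc i)))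
       + 2 * thetas d a (Suc i) * (Ephi d a b c (Suc i) + Ephi d a b c (Suc (Suc i))) + Ephi d a b c (Suc i) * (thetas d a i + thetas d a (Suc i)) - thetas d b (Suc i)
       = 2 * Ecst d a b c * thetas d a (Suc i) + Ecst d a c b"
    by (cases "even i") (simp_all add: thetas_def Ephi_def Ecst_def field_simps power2_eq_square)
  show "(thetas d b i + thetas d b (Suc i)) * (thetas d a i + thetas d a (Suc i)) + Ephi d a b c (Suc (Suc i)) + 2 * Ephi d a b c (Suc i) + Ephi d a b c i
       + 2 * (thetas d b i * thetas d a i + thetas d b (Suc i) * thetas d a (Suc i)) = 2 * Ecst d a b c"
    by (cases "even i") (simp_all add: thetas_def Ephi_def Ecst_def field_simps power2_eq_square)
qed (simp_all add: Ephi_def thetas_sq thetas_sum3 thetas_def Ecst_def field_simps power2_eq_square)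

lemma E_rel_YX:
  assumes "odd d"
  shows "bi_rel d (LY d (thetas d b) (Ephi d a b c)) (LX d (thetas d a)) (Ecst d a b c) (Ecst d b c a)"
proof (rule bi_rel_YX)
  show "Ephi d a b c (Suc d) = 0" using assms by (simp add: Ephi_def)
  fix i
  show "4 * thetas d a (Suc i) * thetas d b (Suc i) ^ 2 + Ephi d a b c (Suc (Suc i)) * (thetas d b (Suc i) + thetas d b (Suc (Suc i)))
       + 2 * thetas d b (Suc i) * (Ephi d a b c (Suc i) + Ephi d a b c (Suc (Suc i))) + Ephi d a b c (Suc i) * (thetas d b i + thetas d b (Suc i)) - thetas d a (Suc i)
       = 2 * Ecst d a b c * thetas d b (Suc i) + Ecst d b c a"
    by (cases "even i") (simp_all add: thetas_def Ephi_def Ecst_def field_simps power2_eq_square)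
  show "(thetas d b i + thetas d b (Suc i)) * (thetas d a i + thetas d a (Suc i)) + Ephi d a b c (Suc (Suc i)) + 2 * Ephi d a b c (Suc i) + Ephi d a b c i
       + 2 * (thetas d b i * thetas d a i + thetas d b (Suc i) * thetas d a (Suc i)) = 2 * Ecst d a b c"
    by (cases "even i") (simp_all add: thetas_def Ephi_def Ecst_def field_simps power2_eq_square)
qed (simp_all add: Ephi_def thetas_sq thetas_sum3 thetas_def Ecst_def field_simps power2_eq_square)

lemma O_rel_XY:
  assumes "even d"
  shows "bi_rel d (LX d (thetas d a)) (LY d (thetas d b) (Ophi d a b c)) (Ocst d a b c) (Ocst d a c b)"
proof (rule bi_rel_XY)
  show "Ophi d a b c (Suc d) = 0" using assms by (simp add: Ophi_def)
  fix i
  show "4 * thetas d b (Suc i) * thetas d a (Suc i) ^ 2 + Ophi d a b c (Suc (Suc i)) * (thetas d a (Suc i) + thetas d a (Suc (Suc i)))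
       + 2 * thetas d a (Suc i) * (Ophi d a b c (Suc i) + Ophi d a b c (Suc (Suc i))) + Ophi d a b c (Suc i) * (thetas d a i + thetas d a (Suc i)) - thetas d b (Suc i)
       = 2 * Ocst d a b c * thetas d a (Suc i) + Ocst d a c b"
    by (cases "even i") (simp_all add: thetas_def Ophi_def Ocst_def field_simps power2_eq_square)
  show "(thetas d b i + thetas d b (Suc i)) * (thetas d a i + thetas d a (Suc i)) + Ophi d a b c (Suc (Suc i)) + 2 * Ophi d a b c (Suc i) + Ophi d a b c i
       + 2 * (thetas d b i * thetas d a i + thetas d b (Suc i) * thetas d a (Suc i)) = 2 * Ocst d a b c"
    by (cases "even i") (simp_all add: thetas_def Ophi_def Ocst_def field_simps power2_eq_square)
qed (simp_all add: Ophi_def thetas_sq thetas_sum3 thetas_def Ocst_def field_simps power2_eq_square)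

lemma O_rel_YX:
  assumes "even d"
  shows "bi_rel d (LY d (thetas d b) (Ophi d a b c)) (LX d (thetas d a)) (Ocst d a b c) (Ocst d b c a)"
proof (rule bi_rel_YX)
  show "Ophi d a b c (Suc d) = 0" using assms by (simp add: Ophi_def)
  fix i
  show "4 * thetas d a (Suc i) * thetas d b (Suc i) ^ 2 + Ophi d a b c (Suc (Suc i)) * (thetas d b (Suc i) + thetas d b (Suc (Suc i)))
       + 2 * thetas d b (Suc i) * (Ophi d a b c (Suc i) + Ophi d a b c (Suc (Suc i))) + Ophi d a b c (Suc i) * (thetas d b i + thetas d b (Suc i)) - thetas d a (Suc i)
       = 2 * Ocst d a b c * thetas d b (Suc i) + Ocst d b c a"
    by (cases "even i") (simp_all add: thetas_def Ophi_def Ocst_def field_simps power2_eq_square)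
  show "(thetas d b i + thetas d b (Suc i)) * (thetas d a i + thetas d a (Suc i)) + Ophi d a b c (Suc (Suc i)) + 2 * Ophi d a b c (Suc i) + Ophi d a b c i
       + 2 * (thetas d b i * thetas d a i + thetas d b (Suc i) * thetas d a (Suc i)) = 2 * Ocst d a b c"
    by (cases "even i") (simp_all add: thetas_def Ophi_def Ocst_def field_simps power2_eq_square)
qed (simp_all add: Ophi_def thetas_sq thetas_sum3 thetas_def Ocst_def field_simps power2_eq_square)

text \<open>For even \<open>d\<close> the reversed eigenvalue sequence of \<open>thetas d b\<close> is not of the form \<open>thetas d b'\<close>,
  but \<open>- thetas d (- b)\<close>; the module below is a sign twist of \<open>O_d(-b, a, -c)\<close>.\<close>

lemma O_rev_rel_XY:
  assumes "even d"
  shows "bi_rel d (LX d (\<lambda>i. - thetas d (- b) i)) (LY d (thetas d a) (\<lambda>i. - Ophi d (- b) a (- c) i)) (Ocst d a b c) (Ocst d b c a)"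
proof (rule bi_rel_XY)
  show "- Ophi d (- b) a (- c) (Suc d) = 0" using assms by (simp add: Ophi_def)
  fix i
  show "(- thetas d (-b) i + - thetas d (-b) (Suc i))\<^sup>2 = 1"
    using thetas_sq[of d "-b" i] by (simp add: power2_eq_square algebra_simps)
  show "4 * thetas d a (Suc i) * (- thetas d (- b) (Suc i)) ^ 2 + - Ophi d (- b) a (- c) (Suc (Suc i)) * (- thetas d (- b) (Suc i) + - thetas d (- b) (Suc (Suc i)))
       + 2 * - thetas d (- b) (Suc i) * (- Ophi d (- b) a (- c) (Suc i) + - Ophi d (- b) a (- c) (Suc (Suc i))) + - Ophi d (- b) a (- c) (Suc i) * (- thetas d (- b) i + - thetas d (- b) (Suc i)) - thetas d a (Suc i)
       = 2 * Ocst d a b c * - thetas d (- b) (Suc i) + Ocst d b c a"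
    by (cases "even i") (simp_all add: thetas_def Ophi_def Ocst_def field_simps power2_eq_square)
  show "(thetas d a i + thetas d a (Suc i)) * (- thetas d (- b) i + - thetas d (- b) (Suc i)) + - Ophi d (- b) a (- c) (Suc (Suc i)) + 2 * - Ophi d (- b) a (- c) (Suc i) + - Ophi d (- b) a (- c) i
       + 2 * (thetas d a i * - thetas d (- b) i + thetas d a (Suc i) * - thetas d (- b) (Suc i)) = 2 * Ocst d a b c"
    by (cases "even i") (simp_all add: thetas_def Ophi_def Ocst_def field_simps power2_eq_square)
qed (simp_all add: Ophi_def thetas_sq thetas_sum3 thetas_def Ocst_def field_simps power2_eq_square)

lemma O_rev_rel_YX:
  assumes "even d"
  shows "bi_rel d (LY d (thetas d a) (\<lambda>i. - Ophi d (- b) a (- c) i)) (LX d (\<lambda>i. - thetas d (- b) i)) (Ocst d a b c) (Ocst d a c b)"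
proof (rule bi_rel_YX)
  show "- Ophi d (- b) a (- c) (Suc d) = 0" using assms by (simp add: Ophi_def)
  fix i
  show "- thetas d (- b) i + 2 * - thetas d (- b) (Suc i) + - thetas d (- b) (Suc (Suc i)) = 0"
    by (simp add: thetas_Suc)
  show "4 * - thetas d (- b) (Suc i) * thetas d a (Suc i) ^ 2 + - Ophi d (- b) a (- c) (Suc (Suc i)) * (thetas d a (Suc i) + thetas d a (Suc (Suc i)))
       + 2 * thetas d a (Suc i) * (- Ophi d (- b) a (- c) (Suc i) + - Ophi d (- b) a (- c) (Suc (Suc i))) + - Ophi d (- b) a (- c) (Suc i) * (thetas d a i + thetas d a (Suc i)) - - thetas d (- b) (Suc i)
       = 2 * Ocst d a b c * thetas d a (Suc i) + Ocst d a c b"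
    by (cases "even i") (simp_all add: thetas_def Ophi_def Ocst_def field_simps power2_eq_square)
  show "(thetas d a i + thetas d a (Suc i)) * (- thetas d (- b) i + - thetas d (- b) (Suc i)) + - Ophi d (- b) a (- c) (Suc (Suc i)) + 2 * - Ophi d (- b) a (- c) (Suc i) + - Ophi d (- b) a (- c) i
       + 2 * (thetas d a i * - thetas d (- b) i + thetas d a (Suc i) * - thetas d (- b) (Suc i)) = 2 * Ocst d a b c"
    by (cases "even i") (simp_all add: thetas_def Ophi_def Ocst_def field_simps power2_eq_square)
qed (simp_all add: Ophi_def thetas_sq thetas_sum3 thetas_def Ocst_def field_simps power2_eq_square)

section \<open>Homomorphisms and irreducibility\<close>

definition lin :: "(('i \<Rightarrow> complex) \<Rightarrow> 'j \<Rightarrow> complex) \<Rightarrow> bool" where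
  "lin U \<longleftrightarrow> (\<forall>u v c. U (\<lambda>i. c * u i + v i) = (\<lambda>i. c * U u i + U v i))"

lemma lin_add: "lin U \<Longrightarrow> U (\<lambda>i. c * u i + v i) = (\<lambda>i. c * U u i + U v i)"
  by (simp add: lin_def)

lemma lin_zero: "lin U \<Longrightarrow> U (\<lambda>i. 0) = (\<lambda>i. 0)"
  using lin_add[of U "-1" "\<lambda>i. 0" "\<lambda>i. 0"] by (auto simp: fun_eq_iff)

lemma lin_scale: "lin U \<Longrightarrow> U (\<lambda>i. c * u i) = (\<lambda>i. c * U u i)"
  using lin_add[of U c u "\<lambda>i. 0"] by (simp add: lin_zero)

lemma lin_sum:
  assumes "lin U" "finite I"
  shows "U (\<lambda>j. \<Sum>i\<in>I. c i * w i j) = (\<lambda>j. \<Sum>i\<in>I. c i * U (w i) j)"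
  using assms(2) by (induction I rule: finite_induct) (auto simp: lin_zero[OF assms(1)] lin_add[OF assms(1)])

lemma lin_LX: "lin (LX d \<theta>)" by (auto simp: lin_def LX_def algebra_simps)
lemma lin_LY: "lin (LY d s \<phi>)" by (auto simp: lin_def LY_def algebra_simps)

lemma Cd_comb: "u \<in> Cd d \<Longrightarrow> v \<in> Cd d \<Longrightarrow> (\<lambda>i. c * u i + v i) \<in> Cd d"
  by (auto simp: Cd_def)

definition unitv :: "nat \<Rightarrow> nat \<Rightarrow> complex" where "unitv i j = (if j = i then 1 else 0)"

lemma unitv_Cd: "i \<le> d \<Longrightarrow> unitv i \<in> Cd d" by (auto simp: unitv_def Cd_def)

lemma Cd_expand: "v \<in> Cd d \<Longrightarrow> v = (\<lambda>j. \<Sum>i\<le>d. v i * unitv i j)"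
  by (auto simp: unitv_def Cd_def fun_eq_iff if_distrib[of "(*) _"] cong: if_cong)

lemma unitv_Suc: "i < d \<Longrightarrow> unitv (Suc i) = (\<lambda>j. - \<theta> i * unitv i j + LX d \<theta> (unitv i) j)"
  by (auto simp: fun_eq_iff unitv_def LX_def)

lemma Cd_generated:
  assumes "i0 \<in> S" and "\<And>a b c. a \<in> S \<Longrightarrow> b \<in> S \<Longrightarrow> (\<lambda>i. c * a i + b i) \<in> S"
    and "\<And>i. i \<le> d \<Longrightarrow> unitv i \<in> S"
  shows "Cd d \<subseteq> S"
proof
  fix v assume v: "v \<in> Cd d"
  have z: "(\<lambda>_. 0) \<in> S" using assms(2)[OF assms(1,1), of "-1"] by simp
  have "(\<lambda>j. \<Sum>i\<in>I. v i * unitv i j) \<in> S" if "finite I" "I \<subseteq> {..d}" for I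
    using that
  proof (induction I rule: finite_induct)
    case (insert x F)
    then show ?case using assms(2)[OF assms(3)[of x]] by simp
  qed (use z in simp)
  from this[of "{..d}"] show "v \<in> S" using Cd_expand[OF v] by simp
qed

section \<open>Products of shifted operators\<close>

text \<open>In a bidiagonal module v_(i+1) = (X - \<theta>_i) v_i, so these products are the images
  that a homomorphism sending v_0 to \<open>v\<close> must give to the later basis vectors.\<close>

primrec shiftprod :: "((nat \<Rightarrow> complex) \<Rightarrow> nat \<Rightarrow> complex) \<Rightarrow> (nat \<Rightarrow> complex) \<Rightarrow> nat \<Rightarrow> (nat \<Rightarrow> complex) \<Rightarrow> nat \<Rightarrow> complex" where
  "shiftprod U t 0 v = v"
| "shiftprod U t (Suc m) v = (\<lambda>i. - t m * shiftprod U t m v i + U (shiftprod U t m v) i)"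

lemma shiftprod_Cd: "v \<in> Cd d \<Longrightarrow> (\<And>w. U w \<in> Cd d) \<Longrightarrow> shiftprod U t m v \<in> Cd d"
  by (induction m) (auto intro: Cd_comb simp del: mult_minus_left)

lemma shiftprod_commute:
  assumes "lin U"
  shows "shiftprod U t m (\<lambda>i. c * v i + U v i) = (\<lambda>i. c * shiftprod U t m v i + U (shiftprod U t m v) i)"
proof (induction m)
  case (Suc m)
  show ?case unfolding shiftprod.simps Suc lin_add[OF assms] by (simp add: algebra_simps)
qed simp

lemma LX_no_eigen:
  assumes "\<And>h. h \<le> d \<Longrightarrow> \<theta> h \<noteq> x" "g \<in> Cd d" "\<And>i. LX d \<theta> g i = x * g i"
  shows "g = (\<lambda>_. 0)"
proof
  fix i show "g i = 0"
  proof (induction i rule: less_induct)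
    case (less i)
    show ?case
    proof (cases "i \<le> d")
      case True
      then have "\<theta> i * g i = x * g i" using assms(3)[of i] less by (auto simp: LX_def split: if_splits)
      then show ?thesis using assms(1)[OF True] by simp
    qed (use assms in \<open>simp add: Cd_def\<close>)
  qed
qed

text \<open>The vectors on which \<open>\<psi>\<close> intertwines \<open>Y\<close> with \<open>V\<close> are, by the cubic relation, closed under
  \<open>v, X v \<mapsto> X\<^sup>2 v\<close>; so it suffices to treat \<open>v\<^sub>0\<close> and \<open>X v\<^sub>0\<close>, where the relation at an
  eigenvector factors as \<open>(V + \<rho>\<^sub>0 + 1)(V + \<rho>\<^sub>0 - 1) U u = c u\<close> and the second factor cancels.\<close>

lemma hom_from_bidiagonal:
  fixes d \<theta> s \<phi> \<tau> \<rho> \<phi>' \<kappa> u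
  defines "V \<equiv> LX d \<theta>" and "U \<equiv> LY d s \<phi>" and "X \<equiv> LX d \<tau>" and "Y \<equiv> LY d \<rho> \<phi>'"
  defines "\<psi> \<equiv> (\<lambda>v j. \<Sum>i\<le>d. v i * shiftprod U \<tau> i u j)"
  assumes P: "bi_rel d U V \<kappa> \<mu>" "bi_rel d V U \<kappa> \<nu>"
    and Q: "bi_rel d X Y \<kappa> \<mu>" "bi_rel d Y X \<kappa> \<nu>"
    and u: "u \<in> Cd d" "\<And>i. V u i = \<rho> 0 * u i"
    and rho: "\<rho> 1 = - 1 - \<rho> 0" and th: "\<And>h. h \<le> d \<Longrightarrow> \<theta> h \<noteq> 1 - \<rho> 0"
    and annih: "shiftprod U \<tau> (Suc d) u = (\<lambda>_. 0)"
    and v: "v \<in> Cd d"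
  shows "\<psi> (X v) = U (\<psi> v)" "\<psi> (Y v) = V (\<psi> v)"
proof -
  note VC = LX_Cd[of d \<theta>, folded V_def] and UC = LY_Cd[of d s \<phi>, folded U_def]
  note XC = LX_Cd[of d \<tau>, folded X_def] and YC = LY_Cd[of d \<rho> \<phi>', folded Y_def]
  have lV: "lin V" and lU: "lin U" and lX: "lin X" and lY: "lin Y"
    unfolding assms(1-4) by (rule lin_LX lin_LY)+
  have lp: "lin \<psi>" by (simp add: lin_def \<psi>_def algebra_simps sum.distrib sum_distrib_left)
  let ?w = "\<lambda>i. shiftprod U \<tau> i u"
  have wC: "?w i \<in> Cd d" for i using u(1) UC by (rule shiftprod_Cd)
  have psiC: "\<psi> v \<in> Cd d" for v using wC by (auto simp: \<psi>_def Cd_def)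
  have Uw: "U (?w i) = (\<lambda>j. \<tau> i * ?w i j + ?w (Suc i) j)" for i by (simp add: fun_eq_iff)
  have pX: "\<psi> (X v) = U (\<psi> v)" for v
  proof
    fix j
    have "\<psi> (X v) j = (\<Sum>i\<le>d. v i * \<tau> i * ?w i j) + (\<Sum>i\<le>d. (if 0 < i then v (i-1) else 0) * ?w i j)"
      unfolding \<psi>_def X_def LX_def by (auto simp: algebra_simps sum.distrib[symmetric] intro!: sum.cong)
    \<comment> \<open>The added term of index d + 1 vanishes by \<open>annih\<close>: X cuts off at
      v_d, and the image has to do the same.\<close>
    also have "(\<Sum>i\<le>d. (if 0 < i then v (i-1) else 0) * ?w i j) = (\<Sum>i\<le>Suc d. (if 0 < i then v (i-1) else 0) * ?w i j)"
      using annih by (simp del: shiftprod.simps)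
    also have "\<dots> = (\<Sum>i\<le>d. v i * ?w (Suc i) j)"
      by (subst sum.atMost_Suc_shift) (simp del: shiftprod.simps)
    finally show "\<psi> (X v) j = U (\<psi> v) j"
      unfolding \<psi>_def lin_sum[OF lU finite_atMost] Uw
      by (simp add: algebra_simps sum.distrib[symmetric] del: shiftprod.simps)
  qed
  then show "\<psi> (X v) = U (\<psi> v)" .
  define S where "S = {v \<in> Cd d. \<psi> (Y v) = V (\<psi> v)}"
  have Scomb: "(\<lambda>i. c * a i + b i) \<in> S" if "a \<in> S" "b \<in> S" for a b c
    using that unfolding S_def by (auto simp: lin_add[OF lY] lin_add[OF lp] lin_add[OF lV] Cd_comb)
  have SXX: "X (X a) \<in> S" if a: "a \<in> S" "X a \<in> S" for a
  proof -
    have aC: "a \<in> Cd d" using a by (simp add: S_def)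
    \<comment> \<open>The cubic relation solved for Y X X a, nested so that \<open>lin_add\<close>
      rewrites it summand by summand.\<close>
    have "Y (X (X a)) = (\<lambda>i. 2 * \<kappa> * X a i + (\<mu> * a i + (1 * Y a i + ((-1) * X (X (Y a)) i + (- 2) * X (Y (X a)) i))))"
      using Q(1) aC by (fastforce simp: bi_rel_def fun_eq_iff algebra_simps)
    then have "\<psi> (Y (X (X a))) = (\<lambda>i. 2 * \<kappa> * U (\<psi> a) i + (\<mu> * \<psi> a i + (1 * V (\<psi> a) i
       + ((-1) * U (U (V (\<psi> a))) i + (- 2) * U (V (U (\<psi> a))) i))))"
      using a by (simp only: lin_add[OF lp] lin_scale[OF lp] pX S_def mem_Collect_eq)
    also have "\<dots> = V (U (U (\<psi> a)))"
      using P(1) psiC[of a] by (fastforce simp: bi_rel_def fun_eq_iff algebra_simps)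
    finally show ?thesis using XC by (simp add: S_def pX)
  qed
  let ?e = unitv
  have e0: "?e 0 \<in> Cd d" by (simp add: unitv_Cd)
  have pe0: "\<psi> (?e 0) = u"
    by (simp add: \<psi>_def unitv_def fun_eq_iff if_distrib[of "\<lambda>x. x * _"] cong: if_cong)
  have Ye0: "Y (?e 0) = (\<lambda>i. \<rho> 0 * ?e 0 i)" by (auto simp: Y_def LY_def unitv_def fun_eq_iff)
  have Vu: "V u = (\<lambda>i. \<rho> 0 * u i)" using u(2) by auto
  have e0S: "?e 0 \<in> S" using e0 by (simp add: S_def Ye0 lin_scale[OF lp] pe0 Vu)
  \<comment> \<open>From Y v_1 = \<rho>_1 v_1 + \<phi>'_1 v_0 with v_1 = X v_0 - \<tau>_0 v_0 and
    \<rho>_0 - \<rho>_1 = 2 \<rho>_0 + 1. For d = 0 there is no v_1.\<close>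
  define c where "c = \<tau> 0 * (2 * \<rho> 0 + 1) + (if d > 0 then \<phi>' 1 else 0)"
  have YX: "Y (X (?e 0)) = (\<lambda>i. (- 1 - \<rho> 0) * X (?e 0) i + c * ?e 0 i)"
    using rho by (auto simp: Y_def X_def LY_def LX_def unitv_def fun_eq_iff c_def le_Suc_eq algebra_simps)
  have c: "c * (2 * \<rho> 0 - 1) = 2 * \<kappa> * \<rho> 0 + \<nu>"
  proof -
    have "Y (Y (X (?e 0))) 0 + 2 * Y (X (Y (?e 0))) 0 + X (Y (Y (?e 0))) 0 - X (?e 0) 0 = 2 * \<kappa> * Y (?e 0) 0 + \<nu> * ?e 0 0"
      using Q(2) e0 by (simp add: bi_rel_def)
    moreover have "?e 0 0 = 1" by (simp add: unitv_def)
    ultimately show ?thesis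
      by (simp add: YX Ye0 lin_add[OF lY] lin_scale[OF lY] lin_scale[OF lX]) (simp add: algebra_simps)
  qed
  \<comment> \<open>The defect of the identity V U u = \<rho>_1 U u + c u. Eliminating \<nu> by
    means of c, the cubic relation gives V g = (1 - \<rho>_0) g, and \<open>th\<close> says that 1 -
    \<rho>_0 is not an eigenvalue of V.\<close>
  define g where "g = (\<lambda>i. (1 + \<rho> 0) * U u i + (- c * u i + V (U u) i))"
  have "g = (\<lambda>_. 0)"
  proof (rule LX_no_eigen)
    show "\<theta> h \<noteq> 1 - \<rho> 0" if "h \<le> d" for h using th that .
    show "g \<in> Cd d" unfolding g_def by (intro Cd_comb UC u VC)
    fix i
    have "V (V (U u)) i + 2 * V (U (V u)) i + U (V (V u)) i - U u i = 2 * \<kappa> * V u i + \<nu> * u i"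
      using P(2) u(1) by (simp add: bi_rel_def)
    moreover have "\<nu> = c * (2 * \<rho> 0 - 1) - 2 * \<kappa> * \<rho> 0" using c by simp
    ultimately have "V g i = (1 - \<rho> 0) * g i"
      unfolding g_def by (simp only: lin_add[OF lV] Vu lin_scale[OF lV] lin_scale[OF lU]) (simp add: algebra_simps)
    then show "LX d \<theta> g i = (1 - \<rho> 0) * g i" by (simp add: V_def)
  qed
  then have "V (U u) = (\<lambda>i. (- 1 - \<rho> 0) * U u i + c * u i)"
    by (simp add: g_def fun_eq_iff algebra_simps)
  then have Xe0S: "X (?e 0) \<in> S"
    using XC by (simp add: S_def YX lin_add[OF lp] lin_scale[OF lp] pX pe0)
  have "i \<le> d \<Longrightarrow> ?e i \<in> S \<and> X (?e i) \<in> S" for i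
  proof (induction i)
    case (Suc i)
    then have IH: "?e i \<in> S" "X (?e i) \<in> S" by auto
    have e: "?e (Suc i) = (\<lambda>j. - \<tau> i * ?e i j + X (?e i) j)"
      unfolding X_def by (rule unitv_Suc) (use Suc in simp)
    show ?case unfolding e lin_add[OF lX] using IH SXX[of "?e i"] Scomb by blast
  qed (use e0S Xe0S in auto)
  then have eS: "?e i \<in> S" if "i \<le> d" for i using that by simp
  have "v \<in> S" using Cd_generated[OF e0S Scomb eS] v by blast
  then show "\<psi> (Y v) = V (\<psi> v)" by (simp add: S_def)
qed

text \<open>A kernel vector with nonzero k-th coordinate makes the image of the k-th basis vector
  redundant, so d vectors would span d + 1 independent ones.\<close>

lemma surj_imp_inj_Cd:
  assumes "lin \<psi>" "\<psi> ` Cd d = Cd d"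
  shows "inj_on \<psi> (Cd d)"
proof -
  interpret vector_space "sc :: complex \<Rightarrow> (nat \<Rightarrow> complex) \<Rightarrow> _"
    by unfold_locales (auto simp: sc_def fun_eq_iff algebra_simps)
  have sum_app: "(\<Sum>x\<in>A. f x) j = (\<Sum>x\<in>A. f x j)" if "finite A" for A j and f :: "nat \<Rightarrow> nat \<Rightarrow> complex"
    using that by (induction A rule: finite_induct) auto
  have inju: "inj_on unitv {..d}"
    by (rule inj_onI) (metis unitv_def zero_neq_one)
  have ind: "independent (unitv ` {..d})"
  proof (rule independent_if_scalars_zero)
    fix f x assume "(\<Sum>x\<in>unitv ` {..d}. sc (f x) x) = 0" and "x \<in> unitv ` {..d}"
    then obtain k where k: "k \<le> d" "x = unitv k" by auto
    from \<open>_ = 0\<close> have "(\<Sum>i\<le>d. sc (f (unitv i)) (unitv i)) k = 0"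
      by (simp add: sum.reindex[OF inju])
    then show "f x = 0"
      using k by (simp add: sum_app sc_def unitv_def if_distrib[of "(*) _"] cong: if_cong)
  qed simp
  have "g = (\<lambda>_. 0)" if g: "g \<in> Cd d" "\<psi> g = (\<lambda>_. 0)" for g
  proof (rule ccontr)
    assume "g \<noteq> (\<lambda>_. 0)"
    then obtain k where k: "g k \<noteq> 0" by auto
    with g(1) have kd: "k \<le> d" by (metis (mono_tags, lifting) Cd_def leI mem_Collect_eq)
    let ?T = "(\<lambda>i. \<psi> (unitv i)) ` ({..d} - {k})"
    have "\<psi> v \<in> span ?T" if v: "v \<in> Cd d" for v
    proof -
      let ?v = "\<lambda>i. (- v k / g k) * g i + v i"
      have "\<psi> v = \<psi> ?v" by (simp only: lin_add[OF assms(1)] g) simp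
      also have "?v = (\<lambda>j. \<Sum>i\<le>d. ?v i * unitv i j)"
        using Cd_expand[OF Cd_comb[OF g(1) v]] .
      also have "\<dots> = (\<lambda>j. \<Sum>i\<in>{..d} - {k}. ?v i * unitv i j)"
        using k kd by (subst sum.remove[of _ k]) auto
      also have "\<psi> \<dots> = (\<Sum>i\<in>{..d} - {k}. sc (?v i) (\<psi> (unitv i)))"
        by (simp add: lin_sum[OF assms(1)] fun_eq_iff sum_app sc_def)
      finally show ?thesis by (simp only:) (intro span_sum span_scale span_base imageI)
    qed
    then have "\<psi> ` Cd d \<subseteq> span ?T" by blast
    then have "unitv ` {..d} \<subseteq> span ?T"
      unfolding assms(2) using unitv_Cd by fastforce
    from independent_span_bound[OF _ ind this]
    have "card (unitv ` {..d}) \<le> card ?T" by simp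
    also have "\<dots> \<le> card ({..d} - {k})" by (rule card_image_le) simp
    finally show False using kd by (simp add: card_image[OF inju])
  qed
  note ker = this
  show ?thesis
  proof (rule inj_onI)
    fix a b assume ab: "a \<in> Cd d" "b \<in> Cd d" "\<psi> a = \<psi> b"
    have "(\<lambda>i. (-1) * b i + a i) = (\<lambda>_. 0)"
      by (rule ker) (unfold lin_add[OF assms(1)] ab(3), use ab in \<open>simp_all add: Cd_def\<close>)
    then show "a = b" by (simp add: fun_eq_iff)
  qed
qed

text \<open>X is lower triangular, so the factors X - \<theta>_k, X - \<theta>_(k+1), ... clear one
  more leading coordinate each.\<close>

lemma shiftprod_LX_support:
  assumes "\<And>j. j < k \<Longrightarrow> v j = 0"
  shows "j < k + m \<Longrightarrow> j \<le> d \<Longrightarrow> shiftprod (LX d \<theta>) (\<lambda>h. \<theta> (k + h)) m v j = 0"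
proof (induction m arbitrary: j)
  case (Suc m)
  then show ?case by (cases "j = k + m") (auto simp: LX_def)
qed (use assms in simp)

text \<open>All factors of the characteristic polynomial except X - \<theta>_0 are applied to v.
  Each multiplies coordinate 0 by a nonzero \<theta>_0 - \<theta>_h; the omitted factor commutes
  with them, and applying it first shows that it annihilates the result.\<close>

lemma LX_eigenvector:
  assumes "v \<in> Cd d" "v 0 \<noteq> 0" "\<And>h. 0 < h \<Longrightarrow> h \<le> d \<Longrightarrow> \<theta> h \<noteq> \<theta> 0"
  defines "u \<equiv> shiftprod (LX d \<theta>) (\<lambda>h. \<theta> (Suc h)) d v"
  shows "u \<in> Cd d" "u 0 \<noteq> 0" "LX d \<theta> u i = \<theta> 0 * u i"
proof -
  show "u \<in> Cd d" unfolding u_def by (rule shiftprod_Cd) (use assms in auto)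
  have "m \<le> d \<Longrightarrow> shiftprod (LX d \<theta>) (\<lambda>h. \<theta> (Suc h)) m v 0 \<noteq> 0" for m
  proof (induction m)
    case (Suc m)
    then show ?case using assms(3)[of "Suc m"] by (simp add: LX_def algebra_simps) 
  qed (use assms in simp)
  then show "u 0 \<noteq> 0" by (simp add: u_def)
  let ?v = "\<lambda>i. - \<theta> 0 * v i + LX d \<theta> v i"
  have "shiftprod (LX d \<theta>) (\<lambda>h. \<theta> (Suc h)) d ?v i = 0"
  proof (cases "i \<le> d")
    case True
    have "?v j = 0" if "j < 1" for j using that by (simp add: LX_def)
    from shiftprod_LX_support[of 1 ?v, OF this] True show ?thesis by simp
  next
    case False
    have "shiftprod (LX d \<theta>) (\<lambda>h. \<theta> (Suc h)) d ?v \<in> Cd d"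
      by (intro shiftprod_Cd Cd_comb assms LX_Cd)
    then show ?thesis using False by (simp add: Cd_def)
  qed
  then show "LX d \<theta> u i = \<theta> 0 * u i"
    unfolding shiftprod_commute[OF lin_LX] by (simp add: u_def)
qed

text \<open>Y is upper triangular, so the factors Y - s_d, Y - s_(d-1), ... clear the coordinates
  from the top: after d of them only the line of v_0 is left, after d + 1 nothing.\<close>

lemma shiftprod_LY_reversed:
  assumes "u \<in> Cd d" "\<And>h. h \<le> d \<Longrightarrow> \<tau> h = s (d - h)"
  shows "m \<le> Suc d \<Longrightarrow> d < j + m \<Longrightarrow> shiftprod (LY d s \<phi>) \<tau> m u j = 0"
proof (induction m arbitrary: j)
  let ?w = "\<lambda>m. shiftprod (LY d s \<phi>) \<tau> m u"
  case (Suc m)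
  show ?case
  proof (cases "d < j + m")
    case True
    then show ?thesis using Suc by (simp add: LY_def)
  next
    case False
    then have "j = d - m" using Suc by simp
    moreover have "?w m (Suc j) = 0" using Suc by simp
    ultimately show ?thesis using Suc.prems assms(2)[of m] by (simp add: LY_def[of d s \<phi> "?w m"])
  qed
qed (use assms in \<open>simp add: Cd_def\<close>)

text \<open>The same annihilating polynomial with the eigenvalues in increasing order. The factors
  commute, so the one for the highest coordinate may act first.\<close>

lemma shiftprod_LY_zero:
  assumes "\<And>j. m \<le> j \<Longrightarrow> v j = 0" "m \<le> Suc d"
  shows "shiftprod (LY d s \<phi>) s m v = (\<lambda>_. 0)"
  using assms
proof (induction m arbitrary: v)
  case 0
  then show ?case by (auto simp: fun_eq_iff)
next
  case (Suc m)
  have "shiftprod (LY d s \<phi>) s m (\<lambda>i. - s m * v i + LY d s \<phi> v i) = (\<lambda>_. 0)"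
  proof (rule Suc.IH)
    fix j assume "m \<le> j"
    then show "- s m * v j + LY d s \<phi> v j = 0"
      using Suc.prems by (cases "j = m") (auto simp: LY_def)
  qed (use Suc in simp)
  then show ?case unfolding shiftprod_commute[OF lin_LY] by simp
qed

lemma sc_plus: "sc c u + v = (\<lambda>i. c * u i + v i)"
  by (simp add: sc_def fun_eq_iff)

lemma bimat_simps:
  "bimat d \<theta> s \<phi> c0 (Suc 0) = LX d \<theta>" "bimat d \<theta> s \<phi> c0 2 = LY d s \<phi>"
  by (auto simp: bimat_def fun_eq_iff)

text \<open>A nonzero submodule contains an eigenvector \<open>u\<close> of \<open>X\<close> for \<open>\<theta>\<^sub>0\<close>. The homomorphism from the module
  with reversed second eigenvalue sequence that sends \<open>v\<^sub>0\<close> to \<open>u\<close> then sends \<open>v\<^sub>d\<close> to a multiple of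
  \<open>v\<^sub>0\<close>, which is nonzero because all \<open>\<phi>'\<^sub>i\<close> are.\<close>

lemma bimat_irred:
  assumes P: "bi_rel d (LX d \<theta>) (LY d s \<phi>) \<kappa> \<nu>" "bi_rel d (LY d s \<phi>) (LX d \<theta>) \<kappa> \<mu>"
    and Q: "bi_rel d (LX d \<tau>) (LY d \<theta> \<phi>') \<kappa> \<mu>" "bi_rel d (LY d \<theta> \<phi>') (LX d \<tau>) \<kappa> \<nu>"
    and tau: "\<And>h. h \<le> d \<Longrightarrow> \<tau> h = s (d - h)"
    and th1: "\<theta> 1 = - 1 - \<theta> 0"
    and th: "\<And>h. h \<le> d \<Longrightarrow> \<theta> h \<noteq> 1 - \<theta> 0" "\<And>h. 0 < h \<Longrightarrow> h \<le> d \<Longrightarrow> \<theta> h \<noteq> \<theta> 0"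
    and phi: "\<And>h. 0 < h \<Longrightarrow> h \<le> d \<Longrightarrow> \<phi> h \<noteq> 0" "\<And>h. 0 < h \<Longrightarrow> h \<le> d \<Longrightarrow> \<phi>' h \<noteq> 0"
  shows "bi_irred (Cd d) (bimat d \<theta> s \<phi> \<kappa>)"
  unfolding bi_irred_def
proof (intro conjI allI impI)
  show "Cd d \<noteq> {0}"
  proof
    assume "Cd d = {0}"
    then have "unitv 0 = 0" using unitv_Cd[of 0 d] by simp
    then have "unitv 0 0 = 0" by simp
    then show False by (simp add: unitv_def)
  qed
  fix S assume "S \<subseteq> Cd d \<and> 0 \<in> S \<and> (\<forall>u\<in>S. \<forall>v\<in>S. \<forall>c. sc c u + v \<in> S) \<and> (\<forall>i\<in>{1, 2, 3}. \<forall>u\<in>S. bimat d \<theta> s \<phi> \<kappa> i u \<in> S)"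
  then have S: "S \<subseteq> Cd d" "0 \<in> S" and comb: "\<And>c u v. u \<in> S \<Longrightarrow> v \<in> S \<Longrightarrow> (\<lambda>i. c * u i + v i) \<in> S"
    and X: "\<And>u. u \<in> S \<Longrightarrow> LX d \<theta> u \<in> S" and Y: "\<And>u. u \<in> S \<Longrightarrow> LY d s \<phi> u \<in> S"
    by (auto simp: sc_plus bimat_simps)
  have sub: "shiftprod U t m v \<in> S" if "v \<in> S" "\<And>u. u \<in> S \<Longrightarrow> U u \<in> S" for U t m v
    using that comb by (induction m) (auto simp del: mult_minus_left)
  have "S = Cd d" if "S \<noteq> {0}"
  proof -
    from that S(2) obtain v0 where "v0 \<in> S" "v0 \<noteq> 0" by blast
    then have ex: "\<exists>k. \<exists>v\<in>S. v k \<noteq> 0" by (auto simp: fun_eq_iff)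
    \<comment> \<open>The least coordinate that is nonzero on S. As \<phi>_k is nonzero, Y would
      lower it further unless k = 0.\<close>
    define k where "k = (LEAST k. \<exists>v\<in>S. v k \<noteq> 0)"
    obtain v where v: "v \<in> S" "v k \<noteq> 0" using LeastI_ex[OF ex] by (auto simp: k_def)
    have low: "w j = 0" if "j < k" "w \<in> S" for j w using that not_less_Least by (auto simp: k_def)
    have kd: "k \<le> d" using v S by (force simp: Cd_def intro: leI)
    have "k = 0"
    proof (rule ccontr)
      assume "k \<noteq> 0"
      then have "LY d s \<phi> v (k - 1) = \<phi> k * v k" using kd low[OF _ v(1), of "k - 1"] by (auto simp: LY_def)
      then show False using low[OF _ Y[OF v(1)], of "k - 1"] v(2) phi(1)[of k] kd \<open>k \<noteq> 0\<close> by simp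
    qed
    define u where "u = shiftprod (LX d \<theta>) (\<lambda>h. \<theta> (Suc h)) d v"
    have u: "u \<in> Cd d" "u 0 \<noteq> 0" "\<And>i. LX d \<theta> u i = \<theta> 0 * u i"
      unfolding u_def by (rule LX_eigenvector; use v S th \<open>k = 0\<close> in auto)+
    have uS: "u \<in> S" unfolding u_def by (rule sub) (use v X in auto)
    let ?w = "\<lambda>i. shiftprod (LY d s \<phi>) \<tau> i u"
    have wS: "?w i \<in> S" for i using uS Y by (rule sub)
    have wC: "?w i \<in> Cd d" for i using wS S by auto
    have wsupp: "?w m j = 0" if "m \<le> Suc d" "d < j + m" for j m
      by (rule shiftprod_LY_reversed[where s = s]) (use u(1) tau that in auto)
    have annih: "?w (Suc d) = (\<lambda>_. 0)" using wsupp[of "Suc d"] by (auto simp: fun_eq_iff simp del: shiftprod.simps)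
    define psi where "psi = (\<lambda>v j. \<Sum>i\<le>d. v i * ?w i j)"
    have psi: "psi (LY d \<theta> \<phi>' v) = LX d \<theta> (psi v)" if "v \<in> Cd d" for v
      unfolding psi_def by (rule hom_from_bidiagonal(2)[OF P(2,1) Q u(1,3) th1 th(1) annih that])
    have psiu: "psi (unitv i) = ?w i" if "i \<le> d" for i
      using that by (simp add: psi_def unitv_def fun_eq_iff if_distrib[of "\<lambda>x. x * _"] cong: if_cong)
    \<comment> \<open>In the reversed module Y v_(i+1) = \<theta>_(i+1) v_(i+1) + \<phi>'_(i+1) v_i,
      so if the image of v_(i+1) is zero then so is that of v_i.\<close>
    have down: "?w i = (\<lambda>_. 0)" if "Suc i \<le> d" "?w (Suc i) = (\<lambda>_. 0)" for i
    proof -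
      have e: "LY d \<theta> \<phi>' (unitv (Suc i)) = (\<lambda>j. \<phi>' (Suc i) * unitv i j + \<theta> (Suc i) * unitv (Suc i) j)"
        using that(1) by (auto simp: fun_eq_iff LY_def unitv_def)
      have lp: "lin psi" by (simp add: psi_def lin_def algebra_simps sum.distrib sum_distrib_left)
      have "psi (LY d \<theta> \<phi>' (unitv (Suc i))) = LX d \<theta> (psi (unitv (Suc i)))"
        using that(1) by (intro psi unitv_Cd)
      then have "(\<lambda>j. \<phi>' (Suc i) * ?w i j) = (\<lambda>_. 0)"
        unfolding e lin_add[OF lp, of "\<phi>' (Suc i)"] lin_scale[OF lp] psiu[OF that(1)] psiu[OF Suc_leD[OF that(1)]] that(2) lin_zero[OF lin_LX]
        by simp
      then show ?thesis using phi(2)[of "Suc i"] that(1) by (simp add: fun_eq_iff)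
    qed
    have "m \<le> d \<Longrightarrow> ?w m \<noteq> (\<lambda>_. 0)" for m
    proof (induction m)
      case 0 then show ?case using u by (auto simp: fun_eq_iff)
    next
      case (Suc m) then show ?case using down[of m] by (auto simp del: shiftprod.simps)
    qed
    from this[of d] have "?w d \<noteq> (\<lambda>_. 0)" by simp
    with wsupp[of d] have w0: "?w d 0 \<noteq> 0" and w: "?w d j = 0" if "j > 0" for j using that
      by (auto simp: fun_eq_iff) (metis gr0I)
    have "unitv 0 = (\<lambda>j. (1 / ?w d 0) * ?w d j + 0)" using w0 w by (auto simp: unitv_def fun_eq_iff)
    then have e0: "unitv 0 \<in> S" using comb[OF wS[of d] S(2), of "1 / ?w d 0"] by simp
    have "i \<le> d \<Longrightarrow> unitv i \<in> S" for i
    proof (induction i)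
      case (Suc i)
      then show ?case unfolding unitv_Suc[OF Suc_le_lessD[OF Suc.prems], of \<theta>] by (intro comb X) auto
    qed (use e0 in simp)
    with Cd_generated[OF e0 comb] S(1) show ?thesis by blast
  qed
  then show "S = {0} \<or> S = Cd d" by blast
qed

text \<open>The homomorphism sending v_0 to an eigenvector for \<theta>_0 is nonzero, hence onto by
  irreducibility and bijective by dimension. X and Y trade places because \<theta> belongs to X in
  the target but to Y in the source.\<close>

lemma bimat_swap_iso:
  assumes P: "bi_rel d (LX d \<theta>) (LY d s \<phi>) \<kappa> \<nu>" "bi_rel d (LY d s \<phi>) (LX d \<theta>) \<kappa> \<mu>"
    and Q: "bi_rel d (LX d \<tau>) (LY d \<theta> \<phi>') \<kappa> \<mu>" "bi_rel d (LY d \<theta> \<phi>') (LX d \<tau>) \<kappa> \<nu>"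
    and annih: "\<And>u. u \<in> Cd d \<Longrightarrow> shiftprod (LY d s \<phi>) \<tau> (Suc d) u = (\<lambda>_. 0)"
    and th1: "\<theta> 1 = - 1 - \<theta> 0"
    and th: "\<And>h. h \<le> d \<Longrightarrow> \<theta> h \<noteq> 1 - \<theta> 0" "\<And>h. 0 < h \<Longrightarrow> h \<le> d \<Longrightarrow> \<theta> h \<noteq> \<theta> 0"
    and irr: "bi_irred (Cd d) (bimat d \<theta> s \<phi> \<kappa>)"
  shows "bi_iso (Cd d) (bimat d \<tau> \<theta> \<phi>' \<kappa>) (Cd d) (twist (\<lambda>_. 1) sw12 (bimat d \<theta> s \<phi> \<kappa>))"
proof -
  define u where "u = shiftprod (LX d \<theta>) (\<lambda>h. \<theta> (Suc h)) d (unitv 0)"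
  have u: "u \<in> Cd d" "u 0 \<noteq> 0" "\<And>i. LX d \<theta> u i = \<theta> 0 * u i"
    unfolding u_def by (rule LX_eigenvector; use th in \<open>auto simp: unitv_Cd\<close>; simp add: unitv_def)+
  let ?U = "LY d s \<phi>" and ?V = "LX d \<theta>" and ?X = "LX d \<tau>" and ?Y = "LY d \<theta> \<phi>'"
  define psi where "psi = (\<lambda>v j. \<Sum>i\<le>d. v i * shiftprod ?U \<tau> i u j)"
  have lp: "lin psi" by (simp add: psi_def lin_def algebra_simps sum.distrib sum_distrib_left)
  have pX: "psi (?X v) = ?U (psi v)" and pY: "psi (?Y v) = ?V (psi v)" if "v \<in> Cd d" for v
    unfolding psi_def by (rule hom_from_bidiagonal[OF P(2,1) Q u(1,3) th1 th(1) annih[OF u(1)] that]; assumption)+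
  have psiC: "psi v \<in> Cd d" for v
  proof -
    have "shiftprod ?U \<tau> i u \<in> Cd d" for i using u(1) LY_Cd by (rule shiftprod_Cd)
    then show ?thesis by (simp add: psi_def Cd_def)
  qed
  let ?S = "psi ` Cd d"
  have comb: "(\<lambda>i. c * a i + b i) \<in> ?S" if ab: "a \<in> ?S" "b \<in> ?S" for a b c
  proof -
    from ab obtain a' b' where "a' \<in> Cd d" "b' \<in> Cd d" and e: "a = psi a'" "b = psi b'" by auto
    then show ?thesis unfolding e lin_add[OF lp, symmetric] by (intro imageI Cd_comb)
  qed
  have VS: "?V a \<in> ?S" and US: "?U a \<in> ?S" if "a \<in> ?S" for a
    using that pX pY by (auto simp: pX[symmetric] pY[symmetric])
  have dif: "bimat d \<theta> s \<phi> \<kappa> 3 a = (\<lambda>i. 1 * ?V (?U a) i + (- \<kappa> * a i + ?U (?V a) i))" for a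
    by (auto simp: bimat_def fun_eq_iff sc_def)
  have Z: "psi (bimat d \<tau> \<theta> \<phi>' \<kappa> 3 v) = bimat d \<theta> s \<phi> \<kappa> 3 (psi v)" if v: "v \<in> Cd d" for v
  proof -
    have "bimat d \<tau> \<theta> \<phi>' \<kappa> 3 v = (\<lambda>i. 1 * ?X (?Y v) i + (- \<kappa> * v i + ?Y (?X v) i))"
      by (auto simp: bimat_def fun_eq_iff sc_def)
    then show ?thesis using v unfolding dif by (simp only: lin_add[OF lp] pX pY LX_Cd LY_Cd) (simp add: fun_eq_iff)
  qed
  have "?S \<noteq> {0}"
  proof -
    have "psi (unitv 0) = u"
      by (simp add: psi_def unitv_def fun_eq_iff if_distrib[of "\<lambda>x. x * _"] cong: if_cong)
    then show ?thesis using u(2) unitv_Cd[of 0 d] by (force simp: fun_eq_iff)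
  qed
  moreover have "?S = {0} \<or> ?S = Cd d"
  proof (rule irr[unfolded bi_irred_def, THEN conjunct2, rule_format], intro conjI ballI allI)
    show "?S \<subseteq> Cd d" using psiC by auto
    have "psi (\<lambda>_. 0) \<in> ?S" by (rule imageI) (simp add: Cd_def)
    then show "0 \<in> ?S" by (simp add: lin_zero[OF lp] zero_fun_def)
    show "sc c a + b \<in> ?S" if "a \<in> ?S" "b \<in> ?S" for a b c unfolding sc_plus using that by (rule comb)
    fix i a assume i: "i \<in> {1,2,3::nat}" and a: "a \<in> ?S"
    have "bimat d \<theta> s \<phi> \<kappa> 3 a \<in> ?S" unfolding dif by (intro comb VS US a)
    then show "bimat d \<theta> s \<phi> \<kappa> i a \<in> ?S" using i a VS US by (auto simp: bimat_simps)
  qed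
  ultimately have surj: "?S = Cd d" by blast
  show ?thesis unfolding bi_iso_def
  proof (intro exI conjI ballI)
    show "lin_on (Cd d) psi" unfolding lin_on_def sc_plus by (simp add: lin_add[OF lp])
    show "bij_betw psi (Cd d) (Cd d)" using surj_imp_inj_Cd[OF lp surj] surj by (simp add: bij_betw_def)
    fix i v assume i: "i \<in> {1,2,3::nat}" and v: "v \<in> Cd d"
    have [simp]: "sc 1 x = x" for x :: "nat \<Rightarrow> complex" by (simp add: sc_def)
    show "psi (bimat d \<tau> \<theta> \<phi>' \<kappa> i v) = twist (\<lambda>_. 1) sw12 (bimat d \<theta> s \<phi> \<kappa>) i (psi v)"
      using i v by (auto simp: twist_def sw12_def bimat_simps pX pY Z)
  qed
qed

section \<open>Transport along twists and isomorphisms\<close>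

lemma bi_irred_twist:
  assumes "bi_irred V A" and nz: "\<And>i. s i \<noteq> 0" and sig: "\<sigma> ` {1,2,3} = {1,2,3}"
  shows "bi_irred V (twist s \<sigma> A)"
  unfolding bi_irred_def
proof (intro conjI allI impI)
  show "V \<noteq> {0}" using assms(1) by (simp add: bi_irred_def)
  fix U assume U: "U \<subseteq> V \<and> 0 \<in> U \<and> (\<forall>u\<in>U. \<forall>v\<in>U. \<forall>c. sc c u + v \<in> U) \<and> (\<forall>i\<in>{1, 2, 3}. \<forall>u\<in>U. twist s \<sigma> A i u \<in> U)"
  have "A j u \<in> U" if "j \<in> {1,2,3}" "u \<in> U" for j u
  proof -
    from that(1) sig have "j \<in> \<sigma> ` {1,2,3}" by simp
    then obtain i where i: "i \<in> {1,2,3}" "j = \<sigma> i" by blast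
    then have "twist s \<sigma> A i u \<in> U" using U that by blast
    then have "sc (1 / s j) (twist s \<sigma> A i u) + 0 \<in> U" using U by blast
    then show ?thesis using nz[of j] by (simp add: i twist_def sc_def)
  qed
  then show "U = {0} \<or> U = V"
    using U by (intro assms(1)[unfolded bi_irred_def, THEN conjunct2, rule_format]) simp
qed

lemma bi_irred_iso:
  assumes "bi_iso V A W B" "bi_irred W B" "0 \<in> V"
  shows "bi_irred V A"
proof -
  from assms(1) obtain f where f: "lin_on V f" "bij_betw f V W" "\<And>i v. i \<in> {1,2,3} \<Longrightarrow> v \<in> V \<Longrightarrow> f (A i v) = B i (f v)"
    unfolding bi_iso_def by blast
  have f0: "f 0 = 0"
  proof -
    have "f (sc (-1) 0 + 0) = sc (-1) (f 0) + f 0" 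
      using f(1)[unfolded lin_on_def, rule_format, OF assms(3) assms(3)] .
    then show ?thesis by (simp add: sc_def zero_fun_def plus_fun_def)
  qed
  have inj: "f x = f y \<longleftrightarrow> x = y" if "x \<in> V" "y \<in> V" for x y
    using f(2) that by (meson bij_betw_imp_inj_on inj_on_eq_iff)
  have im: "f ` V = W" using f(2) by (simp add: bij_betw_def)
  show ?thesis unfolding bi_irred_def
  proof (intro conjI allI impI)
    show "V \<noteq> {0}" using assms(2)[unfolded bi_irred_def, THEN conjunct1] im f0 by auto
    fix U assume U: "U \<subseteq> V \<and> 0 \<in> U \<and> (\<forall>u\<in>U. \<forall>v\<in>U. \<forall>c. sc c u + v \<in> U) \<and> (\<forall>i\<in>{1, 2, 3}. \<forall>u\<in>U. A i u \<in> U)"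
    have "f ` U = {0} \<or> f ` U = W"
    proof (rule assms(2)[unfolded bi_irred_def, THEN conjunct2, rule_format], intro conjI ballI allI)
      show "f ` U \<subseteq> W" using U im by blast
      show "0 \<in> f ` U" using U f0[symmetric] by blast
      show "sc c a + b \<in> f ` U" if "a \<in> f ` U" "b \<in> f ` U" for a b c
      proof -
        from that obtain a' b' where e: "a = f a'" "b = f b'" and ab: "a' \<in> U" "b' \<in> U" by auto
        then have "sc c a + b = f (sc c a' + b')" using f(1) U unfolding lin_on_def by (simp add: subset_iff)
        then show ?thesis using U ab by blast
      qed
      show "B i a \<in> f ` U" if "i \<in> {1,2,3}" "a \<in> f ` U" for i a
      proof -
        from that obtain a' where "a = f a'" "a' \<in> U" by auto
        then have "B i a = f (A i a')" using f(3)[OF that(1), of a'] U by auto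
        then show ?thesis using U that \<open>a' \<in> U\<close> by blast
      qed
    qed
    then show "U = {0} \<or> U = V"
    proof
      assume "f ` U = {0}"
      have "u = 0" if u: "u \<in> U" for u
      proof -
        have "f u \<in> f ` U" using u by (rule imageI)
        then have "f u = f 0" using \<open>f ` U = {0}\<close> f0 by simp
        moreover have "u \<in> V" using U u by blast
        ultimately show ?thesis using inj[of u 0] assms(3) by simp
      qed
      then have "U \<subseteq> {0}" by auto
      then show ?thesis using U by auto
    next
      assume "f ` U = W"
      then have "U = V" using im U inj_on_image_eq_iff[OF bij_betw_imp_inj_on[OF f(2)], of U V] by simp
      then show ?thesis by simp
    qed
  qed
qed

lemma bi_iso_sym:
  assumes "bi_iso V A W B" and "\<And>u v c. u \<in> V \<Longrightarrow> v \<in> V \<Longrightarrow> sc c u + v \<in> V"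
    and "\<And>i v. i \<in> {1,2,3} \<Longrightarrow> v \<in> V \<Longrightarrow> A i v \<in> V"
  shows "bi_iso W B V A"
proof -
  from assms(1) obtain f where f: "lin_on V f" "bij_betw f V W" "\<And>i v. i \<in> {1,2,3} \<Longrightarrow> v \<in> V \<Longrightarrow> f (A i v) = B i (f v)"
    unfolding bi_iso_def by blast
  define g where "g = inv_into V f"
  have g: "bij_betw g W V" unfolding g_def using f(2) by (rule bij_betw_inv_into)
  have gV: "w \<in> W \<Longrightarrow> g w \<in> V" for w using g by (rule bij_betwE[THEN bspec])
  have fg: "f (g w) = w" if "w \<in> W" for w using f(2) that unfolding g_def by (rule bij_betw_inv_into_right)
  have gf: "g (f v) = v" if "v \<in> V" for v using f(2) that unfolding g_def by (rule bij_betw_inv_into_left)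
  show ?thesis unfolding bi_iso_def
  proof (intro exI conjI ballI)
    show "lin_on W g" unfolding lin_on_def
    proof (intro ballI allI)
      fix u v c assume uv: "u \<in> W" "v \<in> W"
      have "sc c u + v = f (sc c (g u) + g v)"
        using f(1) gV uv unfolding lin_on_def by (simp add: fg)
      then show "g (sc c u + v) = sc c (g u) + g v" using gf assms(2) gV uv by simp
    qed
    fix i w assume i: "i \<in> {1,2,3::nat}" and w: "w \<in> W"
    have "B i w = f (A i (g w))" using f(3)[OF i gV[OF w]] fg[OF w] by simp
    then show "g (B i w) = A i (g w)" using gf assms(3)[OF i gV[OF w]] by simp
  qed (rule g)
qed

lemma bi_iso_twist:
  assumes "bi_iso V A W B" "0 \<in> V" "\<sigma> ` {1,2,3} \<subseteq> {1,2,3}"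
    and "\<And>i v. i \<in> {1,2,3} \<Longrightarrow> v \<in> V \<Longrightarrow> A i v \<in> V"
  shows "bi_iso V (twist s \<sigma> A) W (twist s \<sigma> B)"
proof -
  from assms(1) obtain f where f: "lin_on V f" "bij_betw f V W" "\<And>i v. i \<in> {1,2,3} \<Longrightarrow> v \<in> V \<Longrightarrow> f (A i v) = B i (f v)"
    unfolding bi_iso_def by blast
  have f0: "f 0 = 0"
  proof -
    have "f (sc (-1) 0 + 0) = sc (-1) (f 0) + f 0" 
      using f(1)[unfolded lin_on_def, rule_format, OF assms(2) assms(2)] .
    then show ?thesis by (simp add: sc_def zero_fun_def plus_fun_def)
  qed
  have sc: "f (sc c v) = sc c (f v)" if "v \<in> V" for c v
    using f(1)[unfolded lin_on_def, rule_format, OF that assms(2), of c] by (simp add: f0)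
  have "f (twist s \<sigma> A i v) = twist s \<sigma> B i (f v)" if "i \<in> {1,2,3}" "v \<in> V" for i v
  proof -
    from assms(3) that(1) have i: "\<sigma> i \<in> {1,2,3}" by blast
    show ?thesis
      unfolding twist_def using sc[OF assms(4)[OF i that(2)]] f(3)[OF i that(2)] by simp
  qed
  then show ?thesis using f unfolding bi_iso_def by blast
qed

lemma Cd_sc: "u \<in> Cd d \<Longrightarrow> v \<in> Cd d \<Longrightarrow> sc c u + v \<in> Cd d"
  unfolding sc_plus by (rule Cd_comb)

lemma Cd_zero: "0 \<in> Cd d" by (simp add: Cd_def)

lemma bimat_Cd: "v \<in> Cd d \<Longrightarrow> bimat d \<theta> s \<phi> \<kappa> i v \<in> Cd d"
  by (auto simp: bimat_def Cd_def LX_def LY_def sc_def)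

lemma twist_Cd:
  "(\<And>i v. v \<in> Cd d \<Longrightarrow> A i v \<in> Cd d) \<Longrightarrow> v \<in> Cd d \<Longrightarrow> twist s \<sigma> A i v \<in> Cd d"
  by (simp add: twist_def sc_def Cd_def)

lemma sw12_image: "sw12 ` {1,2,3} = {1,2,3}" by (auto simp: sw12_def)

lemma sw12_sw12: "sw12 (sw12 i) = i" by (simp add: sw12_def)

lemma sgn_mm_sw12: "sgn_mm (sw12 i) = sgn_mm i" by (auto simp: sw12_def sgn_mm_def)

lemma sc_one: "sc 1 v = v" by (simp add: sc_def)

section \<open>Separated eigenvalues and nonzero entries for the modules at hand\<close>

lemma thetas_of_real:
  "thetas d (of_real x) h = of_real ((-1) ^ h * (x - real d / 2 + real h))"
  by (simp add: thetas_def)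

text \<open>With y = x - d/2 the eigenvalues are y, -(y+1), y+2, ... of growing absolute value; y >
  1/2 keeps the later ones away from y and all of them away from 1 - y.\<close>

lemma thetas_distinct_pos:
  assumes "x - real d / 2 > 1 / 2"
  shows "thetas d (of_real x) h \<noteq> 1 - thetas d (of_real x) 0"
    and "h > 0 \<Longrightarrow> thetas d (of_real x) h \<noteq> thetas d (of_real x) 0"
proof -
  have e: "1 - thetas d (of_real x) 0 = of_real (1 - (x - real d / 2))"
    by (simp add: thetas_of_real)
  show "thetas d (of_real x) h \<noteq> 1 - thetas d (of_real x) 0"
    unfolding e unfolding thetas_of_real of_real_eq_iff
    using assms by (cases "even h") auto
  show "h > 0 \<Longrightarrow> thetas d (of_real x) h \<noteq> thetas d (of_real x) 0"
    unfolding thetas_of_real of_real_eq_iff using assms by (cases "even h") auto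
qed

text \<open>With y = x - d/2, every y + h is negative. Eigenvalues of even index are then negative
  while 1 - y is positive; those of odd index are positive but at most -y.\<close>

lemma thetas_distinct_neg:
  assumes "x + real d / 2 < 0" "h \<le> d"
  shows "thetas d (of_real x) h \<noteq> 1 - thetas d (of_real x) 0"
    and "h > 0 \<Longrightarrow> thetas d (of_real x) h \<noteq> thetas d (of_real x) 0"
proof -
  have h: "real h \<le> real d" using assms by simp
  have e: "1 - thetas d (of_real x) 0 = of_real (1 - (x - real d / 2))"
    by (simp add: thetas_of_real)
  show "thetas d (of_real x) h \<noteq> 1 - thetas d (of_real x) 0"
    unfolding e unfolding thetas_of_real of_real_eq_iff
    using assms h by (cases "even h") auto
  show "h > 0 \<Longrightarrow> thetas d (of_real x) h \<noteq> thetas d (of_real x) 0"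
    unfolding thetas_of_real of_real_eq_iff using assms h by (cases "even h") auto
qed

lemma thetas_first: "thetas d a 1 = - 1 - thetas d a 0"
  using thetas_Suc[of d a 0] by simp

lemma thetas_reversed_odd:
  assumes "odd d" "h \<le> d"
  shows "thetas d b h = thetas d (- b) (d - h)"
proof -
  from assms(2) obtain m where "d = h + m" using le_Suc_ex by blast
  then show ?thesis using assms(1) by (cases "even h") (simp_all add: thetas_def field_simps)
qed

lemma thetas_reversed_even:
  assumes "even d" "h \<le> d"
  shows "- thetas d (- b) h = thetas d b (d - h)"
proof -
  from assms(2) obtain m where "d = h + m" using le_Suc_ex by blast
  then show ?thesis using assms(1) by (cases "even h") (simp_all add: thetas_def field_simps)
qed

lemma if_of_nat_nonzero:
  "A \<noteq> 0 \<Longrightarrow> B \<noteq> 0 \<Longrightarrow> (if P then of_nat A else of_nat B) \<noteq> (0 :: complex)"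
  by simp

lemma if_of_real_nonzero:
  "A \<noteq> 0 \<Longrightarrow> B \<noteq> 0 \<Longrightarrow> (if P then of_real A else of_real B) \<noteq> (0 :: complex)"
  by simp

text \<open>E_d(b, a, N) serves as second presentation both for irreducibility and for the
  isomorphism: its first eigenvalue sequence is that of -b reversed, and the sign of b does not
  affect the central values.\<close>

lemma E_irred_iso:
  fixes t1 t2 d n :: nat and k1 k2 k3 :: real
  assumes n: "n = d + t1 + t2" "odd d" and k: "k1 = - real t1 / 2" "k2 = - real t2 / 2" "k3 \<ge> 0" "t1 > 0"
  defines "a \<equiv> of_real k2 + of_real k3 + Ncst n" and "b \<equiv> of_real k1 + of_real k3 + Ncst n"
  shows "bi_irred (Cd d) (Emod d a (- b) (Ncst n))"
    and "bi_iso (Cd d) (Emod d b a (Ncst n)) (Cd d) (twist (\<lambda>_. 1) sw12 (Emod d a (- b) (Ncst n)))"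
proof -
  define N where "N = Ncst n"
  define x where "x = k2 + k3 + (real n + 1) / 2"
  have a: "a = of_real x" by (simp add: a_def x_def Ncst_def)
  \<comment> \<open>Here x - d/2 = k_3 + (t_1 + 1)/2.\<close>
  have xd: "x - real d / 2 > 1 / 2" unfolding x_def n k using k by (simp add: field_simps)
  note P = E_rel_XY[OF n(2), of a "- b" N] E_rel_YX[OF n(2), of "- b" a N]
  have Q: "bi_rel d (LX d (thetas d b)) (LY d (thetas d a) (Ephi d b a N)) (Ecst d a (- b) N) (Ecst d (- b) N a)"
    "bi_rel d (LY d (thetas d a) (Ephi d b a N)) (LX d (thetas d b)) (Ecst d a (- b) N) (Ecst d a N (- b))"
    using E_rel_XY[OF n(2), of b a N] E_rel_YX[OF n(2), of a b N]
    by (simp_all add: Ecst_def algebra_simps)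
  have tau: "thetas d b h = thetas d (- b) (d - h)" if "h \<le> d" for h
    using n(2) that by (rule thetas_reversed_odd)
  have phi: "Ephi d a (- b) N h \<noteq> 0" and phi': "Ephi d b a N h \<noteq> 0" if h: "0 < h" "h \<le> d" for h
  proof -
    from h obtain m where m: "d = h + m" using le_Suc_ex by blast
    \<comment> \<open>For odd h the entry is a difference of two squares; inserting k_1, k_2 and n
      turns both of its factors into positive integers.\<close>
    have e: "Ephi d a (- b) N h = (if even h then of_nat (h * (m + 1)) else of_nat ((m + t2 + 1) * (t1 + h)))"
      unfolding Ephi_def a_def b_def N_def Ncst_def n k m by (simp add: field_simps power2_eq_square)
    show "Ephi d a (- b) N h \<noteq> 0" unfolding e by (rule if_of_nat_nonzero) (use h in simp_all)
    have e: "Ephi d b a N h = (if even h then of_real (real h * (real m + 1)) else of_real (- (2 * k3 + real h) * (2 * k3 + real n + 1 + real h)))"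
      unfolding Ephi_def a_def b_def N_def Ncst_def n k(1,2) m by (simp add: field_simps power2_eq_square)
    have "2 * k3 + real h > 0" "2 * k3 + real n + 1 + real h > 0" using k h by auto
    then show "Ephi d b a N h \<noteq> 0" unfolding e using h by (intro if_of_real_nonzero) auto
  qed
  show irr: "bi_irred (Cd d) (Emod d a (- b) (Ncst n))"
    unfolding Emod_eq N_def[symmetric]
    by (rule bimat_irred[OF P Q tau thetas_first _ _ phi phi'])
      (simp_all only: a thetas_distinct_pos[OF xd] not_False_eq_True)
  have "bi_iso (Cd d) (bimat d (thetas d b) (thetas d a) (Ephi d b a N) (Ecst d a (- b) N)) (Cd d) (twist (\<lambda>_. 1) sw12 (Emod d a (- b) (Ncst n)))"
    unfolding Emod_eq N_def[symmetric]
  proof (rule bimat_swap_iso[OF P Q])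
    show "bi_irred (Cd d) (bimat d (thetas d a) (thetas d (- b)) (Ephi d a (- b) N) (Ecst d a (- b) N))"
      using irr unfolding Emod_eq N_def[symmetric] .
    fix u assume "u \<in> Cd d"
    then show "shiftprod (LY d (thetas d (- b)) (Ephi d a (- b) N)) (thetas d b) (Suc d) u = (\<lambda>_. 0)"
      by (intro ext shiftprod_LY_reversed tau) auto
  qed (use thetas_first thetas_distinct_pos[OF xd] in \<open>simp_all add: a\<close>)
  moreover have "Ecst d a (- b) N = Ecst d b a N" by (simp add: Ecst_def)
  ultimately show "bi_iso (Cd d) (Emod d b a (Ncst n)) (Cd d) (twist (\<lambda>_. 1) sw12 (Emod d a (- b) (Ncst n)))"
    unfolding Emod_eq N_def[symmetric] by simp
qed

text \<open>The parameter b stands first because its eigenvalues are separated by t + t' \<le> n and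
  k_3 \<ge> 0. Irreducibility uses the reversed module. The isomorphism uses O_d(k_3, b, c), whose
  first eigenvalue sequence is that of Y in the target, in the same order.\<close>

lemma O_irred_iso:
  fixes t t' d n :: nat and k c k3 :: real
  assumes d: "t = Suc d" "even d" and n: "t + t' \<le> n"
    and k: "k = - real t / 2" "c = - real t' / 2" "k3 \<ge> 0"
    and b: "b = - of_real (k + c + k3) - of_nat n - 1"
  shows "bi_irred (Cd d) (Omod d b (of_real k3) (of_real c))"
    and "bi_iso (Cd d) (Omod d (of_real k3) b (of_real c)) (Cd d) (twist (\<lambda>_. 1) sw12 (Omod d b (of_real k3) (of_real c)))"
proof -
  define a where "a = complex_of_real k3"
  define C where "C = complex_of_real c"
  define x where "x = - (k + c + k3) - real n - 1"
  have bx: "b = of_real x" by (simp add: b x_def)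
  have "real t + real t' \<le> real n" using n by linarith
  then have xd: "x + real d / 2 < 0" using k(3) unfolding x_def k d by (simp add: field_simps)
  note P = O_rel_XY[OF d(2), of b a C] O_rel_YX[OF d(2), of a b C]
  have Q': "bi_rel d (LX d (thetas d a)) (LY d (thetas d b) (Ophi d a b C)) (Ocst d b a C) (Ocst d a C b)"
    "bi_rel d (LY d (thetas d b) (Ophi d a b C)) (LX d (thetas d a)) (Ocst d b a C) (Ocst d b C a)"
    using O_rel_XY[OF d(2), of a b C] O_rel_YX[OF d(2), of b a C]
    by (simp_all add: Ocst_def algebra_simps)
  have phi: "Ophi d b a C h \<noteq> 0" and phi': "- Ophi d (- a) b (- C) h \<noteq> 0" if h: "0 < h" "h \<le> d" for h
  proof -
    from h obtain m where m: "d = h + m" using le_Suc_ex by blast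
    \<comment> \<open>The slack in t + t' \<le> n; in terms of m and r all factors below are visibly
      nonzero.\<close>
    from n obtain r where r: "n = t + t' + r" using le_Suc_ex by blast
    have e: "Ophi d b a C h = (if even h then of_real (real (h * (2 + m + t' + r))) else of_real (- real ((m + 1) * (2 + m + r))))"
      unfolding Ophi_def a_def C_def b k r d m by (simp add: field_simps)
    show "Ophi d b a C h \<noteq> 0" unfolding e
      by (rule if_of_real_nonzero) (use h in \<open>simp_all del: of_nat_mult of_nat_add\<close>)
    have e: "- Ophi d (- a) b (- C) h = (if even h then of_real (- real h * (2 * k3 + real (m + 2 + r)))
        else of_real ((real m + 1) * (2 * k3 + real (m + 2 + t' + r))))"
      unfolding Ophi_def a_def C_def b k(1,2) r d m by (simp add: field_simps)
    have "2 * k3 + real (m + 2 + r) > 0" "2 * k3 + real (m + 2 + t' + r) > 0" using k by auto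
    then show "- Ophi d (- a) b (- C) h \<noteq> 0"
      unfolding e using h by (intro if_of_real_nonzero) (simp_all del: of_nat_add)
  qed
  show irr: "bi_irred (Cd d) (Omod d b (of_real k3) (of_real c))"
    unfolding Omod_eq a_def[symmetric] C_def[symmetric]
  proof (rule bimat_irred[OF P])
    show "bi_rel d (LX d (\<lambda>i. - thetas d (- a) i)) (LY d (thetas d b) (\<lambda>i. - Ophi d (- a) b (- C) i)) (Ocst d b a C) (Ocst d a C b)"
      by (rule O_rev_rel_XY[OF d(2)])
    show "bi_rel d (LY d (thetas d b) (\<lambda>i. - Ophi d (- a) b (- C) i)) (LX d (\<lambda>i. - thetas d (- a) i)) (Ocst d b a C) (Ocst d b C a)"
      by (rule O_rev_rel_YX[OF d(2)])
    show "- thetas d (- a) h = thetas d a (d - h)" if "h \<le> d" for h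
      using d(2) that by (rule thetas_reversed_even)
  qed (use thetas_first thetas_distinct_neg[OF xd] phi phi' in \<open>simp_all add: bx\<close>)
  have "bi_iso (Cd d) (bimat d (thetas d a) (thetas d b) (Ophi d a b C) (Ocst d b a C)) (Cd d) (twist (\<lambda>_. 1) sw12 (Omod d b (of_real k3) (of_real c)))"
    unfolding Omod_eq a_def[symmetric] C_def[symmetric]
  proof (rule bimat_swap_iso[OF P Q'])
    show "bi_irred (Cd d) (bimat d (thetas d b) (thetas d a) (Ophi d b a C) (Ocst d b a C))"
      using irr unfolding Omod_eq a_def[symmetric] C_def[symmetric] .
    fix u assume "u \<in> Cd d"
    then show "shiftprod (LY d (thetas d a) (Ophi d b a C)) (thetas d a) (Suc d) u = (\<lambda>_. 0)"
      by (intro shiftprod_LY_zero) (auto simp: Cd_def)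
  qed (use thetas_first thetas_distinct_neg[OF xd] in \<open>simp_all add: bx\<close>)
  moreover have "Ocst d b a C = Ocst d a b C" by (simp add: Ocst_def)
  ultimately show "bi_iso (Cd d) (Omod d (of_real k3) b (of_real c)) (Cd d) (twist (\<lambda>_. 1) sw12 (Omod d b (of_real k3) (of_real c)))"
    unfolding Omod_eq a_def[symmetric] C_def[symmetric] by simp
qed

section \<open>Restriction to the plane where the third variable vanishes\<close>

text \<open>\<open>T\<^sub>i x\<^sub>i\<^sup>m = br k\<^sub>i m x\<^sub>i\<^sup>m\<^sup>-\<^sup>1\<close>.\<close>

definition br :: "real \<Rightarrow> nat \<Rightarrow> complex" where
  "br k m = of_nat m + (if odd m then 2 * of_real k else 0)"

text \<open>The eigenvalue of the third Pauli matrix, and the only trace of the spinor component in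
  the formulas on x_3 = 0.\<close>

definition sg :: "bool \<Rightarrow> complex" where "sg s = (if s then -1 else 1)"

lemma dunkl_apply:
  "dunkl k1 k2 k3 (Suc 0) f ((a,b,c),s) = br k1 (Suc a) * f ((Suc a,b,c),s)"
  "dunkl k1 k2 k3 2 f ((a,b,c),s) = br k2 (Suc b) * f ((a,Suc b,c),s)"
  "dunkl k1 k2 k3 3 f ((a,b,c),s) = br k3 (Suc c) * f ((a,b,Suc c),s)"
  by (auto simp: dunkl_def dpart_def divx_def refl_def sc_def kk_def comp_def addi_def br_def algebra_simps)

lemma refl_apply:
  "refl (Suc 0) f ((a,b,c),s) = (-1) ^ a * f ((a,b,c),s)"
  "refl 2 f ((a,b,c),s) = (-1) ^ b * f ((a,b,c),s)"
  "refl 3 f ((a,b,c),s) = (-1) ^ c * f ((a,b,c),s)"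
  by (auto simp: refl_def comp_def)

lemma mulx_apply:
  "mulx (Suc 0) f ((a,b,c),s) = (if 0 < a then f ((a-1,b,c),s) else 0)"
  "mulx 2 f ((a,b,c),s) = (if 0 < b then f ((a,b-1,c),s) else 0)"
  "mulx 3 f ((a,b,c),s) = (if 0 < c then f ((a,b,c-1),s) else 0)"
  by (auto simp: mulx_def comp_def subi_def)

lemma sig_apply:
  "sig (Suc 0) f (\<alpha>, s) = f (\<alpha>, \<not> s)"
  "sig 2 f (\<alpha>, s) = (if s then \<i> * f (\<alpha>, False) else - \<i> * f (\<alpha>, True))"
  "sig 3 f (\<alpha>, s) = sg s * f (\<alpha>, s)"
  by (auto simp: sig_def sg_def)

text \<open>D f = 0 multiplied by e_3 and solved for T_3 f: a recursion from x_3-degree c to c + 1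
  that flips the spinor component.\<close>

lemma dirac_zero_iff:
  "dirac k1 k2 k3 f = 0 \<longleftrightarrow> (\<forall>a b c s. br k3 (Suc c) * f ((a,b,Suc c),s) =
     - sg s * br k1 (Suc a) * f ((Suc a,b,c),\<not> s) + \<i> * br k2 (Suc b) * f ((a,Suc b,c),\<not> s))"
  (is "?L \<longleftrightarrow> (\<forall>a b c s. ?P a b c s)")
proof -
  have "dirac k1 k2 k3 f ((a,b,c),s) = 0 \<longleftrightarrow> ?P a b c s" for a b c s
    by (cases s) (auto simp: dirac_def sig_apply dunkl_apply sg_def algebra_simps add_eq_0_iff eq_neg_iff_add_eq_0)
  then show ?thesis by (auto simp: fun_eq_iff)
qed

text \<open>The term x_2 T_3 of X brings in coefficients of x_3-degree 1, but only together with the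
  factor \<open>br k3 1\<close>, so the Dirac equation eliminates them without a division. It flips
  the spinor component, as does e_1; together they preserve it.\<close>

lemma X_apply:
  assumes "dirac k1 k2 k3 f = 0"
  shows "biact k1 k2 k3 (Suc 0) f ((a,b,0),s) =
    (if 0 < b then - \<i> * sg s * (-1) ^ b * br k1 (Suc a) * f ((Suc a,b-1,0),s) else 0)
    + (-1) ^ b * (of_nat b + 1/2 + of_real k2 + of_real k3) * f ((a,b,0),s)"
proof -
  have d: "br k3 (Suc 0) * f ((a,b-1,Suc 0),s') =
     - sg s' * br k1 (Suc a) * f ((Suc a,b-1,0),\<not> s') + \<i> * br k2 b * f ((a,b,0),\<not> s')" if "b > 0" for s'
    using assms that unfolding dirac_zero_iff by (metis Suc_pred')
  have "biact k1 k2 k3 (Suc 0) f ((a,b,0),s) =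
    (if 0 < b then - \<i> * (-1) ^ b * (br k3 (Suc 0) * f ((a,b-1,Suc 0),\<not> s)) else 0)
    + ((-1) ^ b * (1/2 + of_real k3) + of_real k2) * f ((a,b,0),s)"
    by (cases b) (auto simp: biact_def Let_def sc_def dunkl_apply refl_apply mulx_apply sig_apply algebra_simps)
  also have "\<dots> = (if 0 < b then - \<i> * sg s * (-1) ^ b * br k1 (Suc a) * f ((Suc a,b-1,0),s) else 0)
    + ((-1) ^ b * (br k2 b + 1/2 + of_real k3) + of_real k2) * f ((a,b,0),s)"
  proof (cases "b = 0")
    case False
    then show ?thesis by (subst d) (simp_all add: sg_def algebra_simps)
  qed (simp add: br_def)
  \<comment> \<open>For odd b the summand 2 k_2 of \<open>br\<close> reverses the sign of the
    separate k_2.\<close>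
  also have "(-1) ^ b * (br k2 b + 1/2 + of_real k3) + of_real k2 = (-1) ^ b * (of_nat b + 1/2 + of_real k2 + of_real k3)"
    by (simp add: br_def)
  finally show ?thesis .
qed

lemma Y_apply:
  assumes "dirac k1 k2 k3 f = 0"
  shows "biact k1 k2 k3 2 f ((a,b,0),s) =
    (if 0 < a then \<i> * sg s * (-1) ^ a * br k2 (Suc b) * f ((a-1,Suc b,0),s) else 0)
    + (-1) ^ a * (of_nat a + 1/2 + of_real k1 + of_real k3) * f ((a,b,0),s)"
proof -
  have d: "br k3 (Suc 0) * f ((a-1,b,Suc 0),s') =
     - sg s' * br k1 a * f ((a,b,0),\<not> s') + \<i> * br k2 (Suc b) * f ((a-1,Suc b,0),\<not> s')" if "a > 0" for s'
    using assms that unfolding dirac_zero_iff by (metis Suc_pred')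
  have "biact k1 k2 k3 2 f ((a,b,0),s) =
    (if 0 < a then sg s * (-1) ^ a * (br k3 (Suc 0) * f ((a-1,b,Suc 0),\<not> s)) else 0)
    + ((-1) ^ a * (1/2 + of_real k3) + of_real k1) * f ((a,b,0),s)"
    by (cases a) (auto simp: biact_def Let_def sc_def dunkl_apply refl_apply mulx_apply sig_apply sg_def algebra_simps)
  also have "\<dots> = (if 0 < a then \<i> * sg s * (-1) ^ a * br k2 (Suc b) * f ((a-1,Suc b,0),s) else 0)
    + ((-1) ^ a * (br k1 a + 1/2 + of_real k3) + of_real k1) * f ((a,b,0),s)"
  proof (cases "a = 0")
    case False
    then show ?thesis by (subst d) (simp_all add: sg_def algebra_simps)
  qed (simp add: br_def)
  also have "(-1) ^ a * (br k1 a + 1/2 + of_real k3) + of_real k1 = (-1) ^ a * (of_nat a + 1/2 + of_real k1 + of_real k3)"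
    by (simp add: br_def)
  finally show ?thesis .
qed

text \<open>Z contains neither x_3 nor T_3, so its coefficients are read off directly. Going through
  {X,Y} would require the Dirac equation for X f and Y f.\<close>

lemma Z_apply:
  "biact k1 k2 k3 3 f ((a,b,0),s) = (-1) ^ (a + b) *
      ((if 0 < b then \<i> * sg s * br k1 (Suc a) * f ((Suc a,b-1,0),s) else 0)
     - (if 0 < a then \<i> * sg s * br k2 (Suc b) * f ((a-1,Suc b,0),s) else 0))
    + ((-1) ^ (a + b) / 2 + of_real k1 * (-1) ^ b + of_real k2 * (-1) ^ a) * f ((a,b,0),s)"
  by (cases a; cases b) (auto simp: biact_def Let_def sc_def dunkl_apply refl_apply mulx_apply sig_apply power_add algebra_simps)

section \<open>Uniqueness and existence of the extension from the plane\<close>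

lemma Mn_degree: "f \<in> Mn k1 k2 k3 n \<Longrightarrow> f ((a,b,c),s) \<noteq> 0 \<Longrightarrow> a + b + c = n"
  by (fastforce simp: Mn_def Pn_def deg_def)

lemma Mn_dirac: "f \<in> Mn k1 k2 k3 n \<Longrightarrow> dirac k1 k2 k3 f = 0"
  by (simp add: Mn_def)

lemma br_nonzero:
  assumes "enat n < tval k" "0 < m" "m \<le> n"
  shows "br k m \<noteq> 0"
proof
  assume "br k m = 0"
  then have "of_real (real m + (if odd m then 2 * k else 0)) = (0::complex)"
    by (cases "odd m") (simp_all add: br_def)
  then have *: "real m + (if odd m then 2 * k else 0) = 0" by (simp only: of_real_eq_0_iff)
  then have "odd m" "2 * k = - real m" using assms(2) by (auto split: if_splits)
  then have "\<exists>m::nat. odd m \<and> 2 * k = - real m" "- 2 * k = real m" by auto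
  then have "tval k = enat m" by (simp add: tval_def)
  then show False using assms by simp
qed

lemma tval_enat:
  assumes "tval k = enat t"
  shows "odd t" "k = - real t / 2" "tnat k = t" "br k t = 0"
proof -
  from assms obtain m :: nat where m: "odd m" "2 * k = - real m" and e: "enat (nat \<lfloor>- 2 * k\<rfloor>) = enat t"
    by (auto simp: tval_def split: if_splits)
  have "- 2 * k = real m" using m by simp
  then have "m = t" using e by simp
  then show "odd t" "k = - real t / 2" using m by auto
  then show "br k t = 0" by (simp add: br_def)
  show "tnat k = t" using assms by (simp add: tnat_def)
qed

text \<open>Raising the x_3-degree calls on the coefficients at a + 1 and b + 1, and a step out of
  the region Q is harmless where its factor \<open>br\<close> vanishes. Regions a < t_1 and b < t_2
  are of this kind; with Q always true this is uniqueness of the extension.\<close>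

lemma Mn_vanish:
  assumes f: "f \<in> Mn k1 k2 k3 n" and k3: "enat n < tval k3"
    and f0: "\<And>a b s. Q a b \<Longrightarrow> f ((a,b,0),s) = 0"
    and Q1: "\<And>a b. Q a b \<Longrightarrow> br k1 (Suc a) = 0 \<or> Q (Suc a) b"
    and Q2: "\<And>a b. Q a b \<Longrightarrow> br k2 (Suc b) = 0 \<or> Q a (Suc b)"
  shows "Q a b \<Longrightarrow> f ((a,b,c),s) = 0"
proof (induction c arbitrary: a b s)
  case (Suc c)
  have "br k3 (Suc c) * f ((a,b,Suc c),s) = 0"
    using Mn_dirac[OF f] Suc.IH Q1[OF Suc.prems] Q2[OF Suc.prems] unfolding dirac_zero_iff by auto
  moreover have "br k3 (Suc c) \<noteq> 0" if "f ((a,b,Suc c),s) \<noteq> 0"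
    using br_nonzero[OF k3, of "Suc c"] Mn_degree[OF f that] by simp
  ultimately show ?case by auto
qed (rule f0)

text \<open>The Dirac equation solved for the coefficients with one more factor \<open>x\<^sub>3\<close>; beyond degree \<open>n\<close> the
  divisor may vanish, but there the numerator is \<open>0\<close> as well.\<close>

primrec ck :: "real \<Rightarrow> real \<Rightarrow> real \<Rightarrow> (nat \<Rightarrow> nat \<Rightarrow> bool \<Rightarrow> complex) \<Rightarrow> nat \<Rightarrow> nat \<Rightarrow> nat \<Rightarrow> bool \<Rightarrow> complex" where
  "ck k1 k2 k3 h 0 = h"
| "ck k1 k2 k3 h (Suc c) = (\<lambda>a b s. (- sg s * br k1 (Suc a) * ck k1 k2 k3 h c (Suc a) b (\<not> s)
     + \<i> * br k2 (Suc b) * ck k1 k2 k3 h c a (Suc b) (\<not> s)) / br k3 (Suc c))"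

lemma Mn_extension:
  assumes k3: "enat n < tval k3" and h: "\<And>a b s. h a b s \<noteq> 0 \<Longrightarrow> a + b = n"
  obtains f where "f \<in> Mn k1 k2 k3 n" "\<And>a b s. f ((a,b,0),s) = h a b s"
proof
  let ?f = "\<lambda>((a,b,c),s). ck k1 k2 k3 h c a b s"
  have deg: "ck k1 k2 k3 h c a b s \<noteq> 0 \<Longrightarrow> a + b + c = n" for a b c s
  proof (induction c arbitrary: a b s)
    case (Suc c)
    then have "ck k1 k2 k3 h c (Suc a) b (\<not> s) \<noteq> 0 \<or> ck k1 k2 k3 h c a (Suc b) (\<not> s) \<noteq> 0" by auto
    then show ?case using Suc.IH by fastforce
  qed (use h in simp)
  have "dirac k1 k2 k3 ?f = 0" unfolding dirac_zero_iff
  proof (intro allI)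
    fix a b c s
    let ?r = "- sg s * br k1 (Suc a) * ck k1 k2 k3 h c (Suc a) b (\<not> s) + \<i> * br k2 (Suc b) * ck k1 k2 k3 h c a (Suc b) (\<not> s)"
    have "br k3 (Suc c) * (?r / br k3 (Suc c)) = ?r"
    proof (cases "Suc c \<le> n")
      case True
      then show ?thesis using br_nonzero[OF k3, of "Suc c"] by simp
    next
      case False
      then have "ck k1 k2 k3 h c (Suc a) b (\<not> s) = 0" "ck k1 k2 k3 h c a (Suc b) (\<not> s) = 0"
        using deg by fastforce+
      then show ?thesis by simp
    qed
    then show "br k3 (Suc c) * ?f ((a,b,Suc c),s) = - sg s * br k1 (Suc a) * ?f ((Suc a,b,c),\<not> s) + \<i> * br k2 (Suc b) * ?f ((a,Suc b,c),\<not> s)"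
      by simp
  qed
  then show "?f \<in> Mn k1 k2 k3 n" using deg by (auto simp: Mn_def Pn_def deg_def)
qed simp

section \<open>From coefficient sequences to normalised bidiagonal modules\<close>

definition low :: "nat \<Rightarrow> (nat \<Rightarrow> complex) \<Rightarrow> (nat \<Rightarrow> complex) \<Rightarrow> (nat \<Rightarrow> complex) \<Rightarrow> nat \<Rightarrow> complex" where
  "low d \<theta> l p i = \<theta> i * p i + (if 0 < i then l i * p (i - 1) else 0)"

definition upp :: "nat \<Rightarrow> (nat \<Rightarrow> complex) \<Rightarrow> (nat \<Rightarrow> complex) \<Rightarrow> (nat \<Rightarrow> complex) \<Rightarrow> nat \<Rightarrow> complex" where
  "upp d s r p i = s i * p i + (if i < d then r (Suc i) * p (Suc i) else 0)"

definition tri where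
  "tri d \<theta> s l r \<kappa> j p i = (if j = (1::nat) then low d \<theta> l p i else if j = 2 then upp d s r p i
     else low d \<theta> l (upp d s r p) i + upp d s r (low d \<theta> l p) i - \<kappa> * p i)"

text \<open>The diagonal change of basis that turns the subdiagonal entries l_i into 1; the
  superdiagonal entries r_i become l_i r_i.\<close>

definition rescale :: "nat \<Rightarrow> (nat \<Rightarrow> complex) \<Rightarrow> (nat \<Rightarrow> complex) \<Rightarrow> nat \<Rightarrow> complex" where
  "rescale d l p i = (if i \<le> d then p i / (\<Prod>h<i. l (Suc h)) else 0)"

lemma rescale_low:
  assumes "\<And>i. 0 < i \<Longrightarrow> i \<le> d \<Longrightarrow> l i \<noteq> 0"
  shows "rescale d l (low d \<theta> l p) = LX d \<theta> (rescale d l p)"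
proof
  fix i show "rescale d l (low d \<theta> l p) i = LX d \<theta> (rescale d l p) i"
    using assms[of i] by (cases i) (auto simp: rescale_def low_def LX_def add_divide_distrib)
qed

lemma rescale_upp:
  assumes "\<And>i. 0 < i \<Longrightarrow> i \<le> d \<Longrightarrow> l i \<noteq> 0" "\<And>i. 0 < i \<Longrightarrow> i \<le> d \<Longrightarrow> l i * r i = \<phi> i"
  shows "rescale d l (upp d s r p) = LY d s \<phi> (rescale d l p)"
proof
  fix i show "rescale d l (upp d s r p) i = LY d s \<phi> (rescale d l p) i"
    using assms(1)[of "Suc i"] assms(2)[of "Suc i", symmetric]
    by (auto simp: rescale_def upp_def LY_def add_divide_distrib)
qed

lemma rescale_tri:
  assumes l: "\<And>i. 0 < i \<Longrightarrow> i \<le> d \<Longrightarrow> l i \<noteq> 0" and lr: "\<And>i. 0 < i \<Longrightarrow> i \<le> d \<Longrightarrow> l i * r i = \<phi> i"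
  shows "rescale d l (tri d \<theta> s l r \<kappa> j p) = bimat d \<theta> s \<phi> \<kappa> j (rescale d l p)"
proof -
  have "rescale d l (\<lambda>i. a i + b i - \<kappa> * p i) = rescale d l a + rescale d l b - sc \<kappa> (rescale d l p)" for a b
    by (auto simp: rescale_def sc_def fun_eq_iff add_divide_distrib diff_divide_distrib)
  then show ?thesis
    by (simp add: tri_def[abs_def] bimat_def rescale_low[OF l] rescale_upp[OF l lr])
qed

text \<open>The map reads off the coefficients at the points \<open>pt i\<close> and rescales them;
  the two spinor components give the two summands. The entries \<open>l\<close> and \<open>r\<close>
  may depend on the component, their product may not.\<close>

lemma quot_iso_from_coefficients:
  fixes l r :: "bool \<Rightarrow> nat \<Rightarrow> complex" and pt :: "nat \<Rightarrow> 'p"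
  assumes l: "\<And>b i. 0 < i \<Longrightarrow> i \<le> d \<Longrightarrow> l b i \<noteq> 0"
    and lr: "\<And>b i. 0 < i \<Longrightarrow> i \<le> d \<Longrightarrow> l b i * r b i = \<phi> i"
    and act: "\<And>f j b i. f \<in> V \<Longrightarrow> j \<in> {1,2,3} \<Longrightarrow> i \<le> d \<Longrightarrow>
      A j f (pt i, b) = s (\<sigma> j) * tri d \<theta> \<theta>s (l b) (r b) \<kappa> (\<sigma> j) (\<lambda>i. f (pt i, b)) i"
    and surj: "\<And>g :: bool \<Rightarrow> nat \<Rightarrow> complex. \<exists>f\<in>V. \<forall>b i. i \<le> d \<longrightarrow> f (pt i, b) = g b i"
    and U: "U = {f \<in> V. \<forall>b i. i \<le> d \<longrightarrow> f (pt i, b) = 0}"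
  shows "bi_quot_iso V U A (dsum2_car (Cd d)) (dsum2 (twist s \<sigma> (bimat d \<theta> \<theta>s \<phi> \<kappa>)))"
  unfolding bi_quot_iso_def
proof (intro exI conjI ballI)
  let ?p = "\<lambda>f (b, i). rescale d (l b) (\<lambda>i. f (pt i, b)) i"
  show "lin_on V ?p"
    by (auto simp: lin_on_def sc_def rescale_def fun_eq_iff add_divide_distrib)
  have prod: "(\<Prod>h<i. l b (Suc h)) \<noteq> 0" if "i \<le> d" for b i
    using that l by simp
  show "?p ` V = dsum2_car (Cd d)"
  proof (intro equalityI subsetI)
    fix w assume "w \<in> ?p ` V"
    then show "w \<in> dsum2_car (Cd d)" by (auto simp: dsum2_car_def Cd_def rescale_def)
  next
    fix w assume w: "w \<in> dsum2_car (Cd d)"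
    from surj[of "\<lambda>b i. w (b, i) * (\<Prod>h<i. l b (Suc h))"]
    obtain f where f: "f \<in> V" "\<And>b i. i \<le> d \<Longrightarrow> f (pt i, b) = w (b, i) * (\<Prod>h<i. l b (Suc h))" by blast
    have "?p f = w"
      using w prod by (auto simp: fun_eq_iff rescale_def f(2) dsum2_car_def Cd_def)
    then show "w \<in> ?p ` V" using f(1) by blast
  qed
  show "{f \<in> V. ?p f = 0} = U"
    unfolding U using prod by (auto simp: rescale_def fun_eq_iff split: if_splits)
  fix j f assume j: "j \<in> {1,2,3::nat}" and f: "f \<in> V"
  have "rescale d (l b) (\<lambda>i. A j f (pt i, b)) = sc (s (\<sigma> j)) (rescale d (l b) (tri d \<theta> \<theta>s (l b) (r b) \<kappa> (\<sigma> j) (\<lambda>i. f (pt i, b))))" for b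
    using act[OF f j] by (auto simp: rescale_def sc_def fun_eq_iff)
  then show "?p (A j f) = dsum2 (twist s \<sigma> (bimat d \<theta> \<theta>s \<phi> \<kappa>)) j (?p f)"
    by (simp add: dsum2_def twist_def fun_eq_iff rescale_tri[OF l lr])
qed

lemma quot_iso_trivial_kernel:
  assumes "bi_quot_iso V {0} A W B" "\<And>u v c. u \<in> V \<Longrightarrow> v \<in> V \<Longrightarrow> sc c u + v \<in> V"
  shows "bi_iso V A W B"
proof -
  from assms(1) obtain f where f: "lin_on V f" "f ` V = W" "{v\<in>V. f v = 0} = {0}"
    "\<forall>i\<in>{1,2,3}. \<forall>v\<in>V. f (A i v) = B i (f v)"
    unfolding bi_quot_iso_def by blast
  have "inj_on f V"
  proof (rule inj_onI)
    fix u v assume uv: "u \<in> V" "v \<in> V" "f u = f v"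
    have "f (sc (-1) u + v) = sc (-1) (f u) + f v" using f(1) uv(1,2) unfolding lin_on_def by simp
    also have "\<dots> = 0" by (simp add: uv(3) sc_def fun_eq_iff)
    finally have "sc (-1) u + v = 0" using f(3) assms(2)[OF uv(1,2)] by blast
    then show "u = v" by (simp add: sc_def fun_eq_iff add_eq_0_iff)
  qed
  then show ?thesis unfolding bi_iso_def using f by (auto simp: bij_betw_def)
qed

lemma br_nonzero_above:
  assumes "k = - real t / 2" "t < m"
  shows "br k m \<noteq> 0"
proof -
  have "br k m = of_real (real m + (if odd m then 2 * k else 0))" by (simp add: br_def)
  moreover have "real m + (if odd m then 2 * k else 0) \<noteq> 0" using assms by auto
  ultimately show ?thesis by (simp only: of_real_eq_0_iff not_False_eq_True)
qed

lemma twist_trivial: "twist (\<lambda>_. 1) id B = B" by (simp add: twist_def sc_def)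

lemma Mnx_iff:
  assumes "tval (kk k1 k2 k3 j) = enat t"
  shows "f \<in> Mnx k1 k2 k3 j n \<longleftrightarrow> f \<in> Mn k1 k2 k3 n \<and> (\<forall>\<alpha> s. comp j \<alpha> < t \<longrightarrow> f (\<alpha>, s) = 0)"
  unfolding Mnx_def assms by (auto simp: not_le[symmetric])

section \<open>The windows cut out by t_1 and t_2\<close>

context
  fixes k1 k2 k3 :: real and n t1 t2 :: nat
  assumes odd: "odd n" and k3: "enat n < tval k3" and t1: "tval k1 = enat t1" and t2: "tval k2 = enat t2"
    and le: "t1 + t2 \<le> n"
begin

text \<open>Since \<open>br k1 t1 = 0\<close>, coefficients with a < t_1 depend on the plane
  coefficients with a < t_1 only, so the condition can be tested at x_3 = 0.\<close>

lemma Mnx1_iff: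
  "f \<in> Mnx k1 k2 k3 (Suc 0) n \<longleftrightarrow> f \<in> Mn k1 k2 k3 n \<and> (\<forall>a b s. a < t1 \<longrightarrow> f ((a,b,0), s) = 0)"
proof -
  have "f ((a,b,c),s) = 0" if f: "f \<in> Mn k1 k2 k3 n" and z: "\<And>a b s. a < t1 \<Longrightarrow> f ((a,b,0), s) = 0" and "a < t1" for a b c s
  proof (rule Mn_vanish[OF f k3, where Q = "\<lambda>a b. a < t1"])
    show "br k1 (Suc a) = 0 \<or> Suc a < t1" if "a < t1" for a
      using that tval_enat(4)[OF t1] by (cases "Suc a = t1") auto
  qed (use z \<open>a < t1\<close> in auto)
  then show ?thesis
    by (subst Mnx_iff[of _ _ _ _ t1]) (auto simp: kk_def t1 comp_def)
qed

lemma Mnx2_iff: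
  "f \<in> Mnx k1 k2 k3 2 n \<longleftrightarrow> f \<in> Mn k1 k2 k3 n \<and> (\<forall>a b s. b < t2 \<longrightarrow> f ((a,b,0), s) = 0)"
proof -
  have "f ((a,b,c),s) = 0" if f: "f \<in> Mn k1 k2 k3 n" and z: "\<And>a b s. b < t2 \<Longrightarrow> f ((a,b,0), s) = 0" and "b < t2" for a b c s
  proof (rule Mn_vanish[OF f k3, where Q = "\<lambda>a b. b < t2"])
    show "br k2 (Suc b) = 0 \<or> Suc b < t2" if "b < t2" for b
      using that tval_enat(4)[OF t2] by (cases "Suc b = t2") auto
  qed (use z \<open>b < t2\<close> in auto)
  then show ?thesis
    by (subst Mnx_iff[of _ _ _ _ t2]) (auto simp: kk_def t2 comp_def)
qed

lemma Mn_off: "f \<in> Mn k1 k2 k3 n \<Longrightarrow> a + b \<noteq> n \<Longrightarrow> f ((a,b,0),s) = 0"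
  using Mn_degree[of f k1 k2 k3 n a b 0 s] by auto

lemma tval_pos: "0 < t1" "0 < t2" using tval_enat(1)[OF t1] tval_enat(1)[OF t2] by (auto intro: odd_pos)

text \<open>Both quotients see exactly the coefficients with b < t_2. There a = n - b > t_1, so
  lying in M_n(x_1) does not restrict them, and one argument covers both cases.\<close>

lemma W3_quot:
  assumes V: "V = Mn k1 k2 k3 n \<and> U = Mnx k1 k2 k3 2 n \<or> V = Mnx k1 k2 k3 (Suc 0) n \<and> U = Mnx k1 k2 k3 (Suc 0) n \<inter> Mnx k1 k2 k3 2 n"
  shows "bi_quot_iso V U (biact k1 k2 k3) (dsum2_car (Cd (t2 - 1)))
     (dsum2 (twist (\<lambda>_. 1) id (Omod (t2 - 1) (of_real k3) (- of_real (k1 + k2 + k3) - of_nat n - 1) (of_real k1))))"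
  unfolding Omod_eq
\<comment> \<open>The off-diagonal entries of X and Y along the window; as n is odd, the sign
  (-1)^(n-i+1) from Y is (-1)^i.\<close>
proof (rule quot_iso_from_coefficients[where pt = "\<lambda>i. (n - i, i, 0)"
    and l = "\<lambda>b i. - \<i> * sg b * (-1) ^ i * br k1 (n - i + 1)" and r = "\<lambda>b i. \<i> * sg b * (-1) ^ i * br k2 i"])
  obtain d where d: "t2 = Suc d" using tval_pos gr0_implies_Suc by blast
  have k: "k1 = - real t1 / 2" "k2 = - real t2 / 2" "odd t1" "odd t2" using tval_enat t1 t2 by auto
  have sg2: "sg b * (sg b * x) = x" for b x by (simp add: sg_def)
  fix b :: bool
  show "- \<i> * sg b * (-1) ^ i * br k1 (n - i + 1) \<noteq> 0" if i: "0 < i" "i \<le> t2 - 1" for i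
  proof -
    have "n - i + 1 > t1" using i le by linarith
    then have "br k1 (n - i + 1) \<noteq> 0" by (rule br_nonzero_above[OF k(1)])
    then show ?thesis by (simp add: sg_def)
  qed
  show "(- \<i> * sg b * (-1) ^ i * br k1 (n - i + 1)) * (\<i> * sg b * (-1) ^ i * br k2 i)
    = Ophi (t2 - 1) (of_real k3) (- of_real (k1 + k2 + k3) - of_nat n - 1) (of_real k1) i" if i: "0 < i" "i \<le> t2 - 1" for i
  proof -
    have "i \<le> n" using i le by linarith
    then obtain m where m: "n = i + m" using le_Suc_ex by blast
    show ?thesis using k(4) odd unfolding m k(2) d
      by (cases "even i") (simp_all add: Ophi_def br_def sg_def field_simps)
  qed
next
  fix f j b i assume f: "f \<in> V" and j: "j \<in> {1,2,3::nat}" and i: "i \<le> t2 - 1"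
  obtain d where d: "t2 = Suc d" using tval_pos gr0_implies_Suc by blast
  have k: "k1 = - real t1 / 2" "k2 = - real t2 / 2" "odd t1" "odd t2" using tval_enat t1 t2 by auto
  have "i < n" using i le tval_pos by linarith
  then obtain m where m: "n = i + Suc m" using less_iff_Suc_add by auto
  have par: "even i \<longleftrightarrow> even m" "even d" using odd k(4) d by (auto simp: m)
  \<comment> \<open>By t_2 = d + 1 the d/2 inside \<open>thetas\<close> is absorbed into
    k_2.\<close>
  have ck: "complex_of_real k2 = - (of_nat d + 1) / 2" by (simp add: k(2) d)
  have th: "thetas d (of_real k3) i = (-1) ^ i * (of_nat i + 1 / 2 + of_real k2 + of_real k3)" for i
    by (simp add: thetas_def ck field_simps)
  have ths: "thetas d (- of_real (k1 + k2 + k3) - of_nat n - 1) i = (-1) ^ i * (of_nat i - of_nat n - 1 / 2 - of_real k1 - of_real k3)" for i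
    by (simp add: thetas_def ck field_simps)
  have f0: "dirac k1 k2 k3 f = 0" using V f Mn_dirac by (auto simp: Mnx_def)
  consider "j = 1" | "j = 2" | "j = 3" using j by auto
  then show "biact k1 k2 k3 j f ((n - i, i, 0), b) = 1 * tri (t2 - 1) (thetas (t2 - 1) (of_real k3)) (thetas (t2 - 1) (- of_real (k1 + k2 + k3) - of_nat n - 1))
      (\<lambda>i. - \<i> * sg b * (-1) ^ i * br k1 (n - i + 1)) (\<lambda>i. \<i> * sg b * (-1) ^ i * br k2 i)
      (Ocst (t2 - 1) (of_real k3) (- of_real (k1 + k2 + k3) - of_nat n - 1) (of_real k1)) (id j) (\<lambda>i. f ((n - i, i, 0), b)) i"
  proof cases
    case 1
    show ?thesis unfolding 1
      by (cases i) (simp_all add: X_apply[OF f0] d m tri_def low_def th)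
  next
    case 2
    \<comment> \<open>At i = d the entry of Y that leads out of the window has the factor
      \<open>br k2 t2 = 0\<close>.\<close>
    show ?thesis unfolding 2 tri_def upp_def d diff_Suc_1 ths
      using i par tval_enat(4)[OF t2]
      by (cases "i = d"; cases "even i") (simp_all add: Y_apply[OF f0] d m algebra_simps)
  next
    case 3
    show ?thesis unfolding 3 tri_def low_def upp_def d diff_Suc_1 th ths
      using i par
      by (cases "i = d"; cases "even i"; cases i)
        (simp_all add: Z_apply d m ck br_def Ocst_def sg_def field_simps)
  qed
next
  fix g :: "bool \<Rightarrow> nat \<Rightarrow> complex"
  obtain f where f: "f \<in> Mn k1 k2 k3 n" "\<And>a b s. f ((a,b,0),s) = (if a + b = n \<and> b \<le> t2 - 1 then g s b else 0)"
    by (rule Mn_extension[OF k3, of "\<lambda>a b s. if a + b = n \<and> b \<le> t2 - 1 then g s b else 0"]) (auto split: if_splits)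
  have "f \<in> V"
    using V f le tval_pos by (auto simp: Mnx1_iff)
  moreover have "f ((n - i, i, 0), b) = g b i" if "i \<le> t2 - 1" for b i
    using that le unfolding f(2) by simp
  ultimately show "\<exists>f\<in>V. \<forall>b i. i \<le> t2 - 1 \<longrightarrow> f ((n - i, i, 0), b) = g b i"
    by blast
next
  have "(\<forall>b i. i \<le> t2 - 1 \<longrightarrow> f ((n - i, i, 0), b) = 0) \<longleftrightarrow> (\<forall>a b s. b < t2 \<longrightarrow> f ((a,b,0), s) = 0)"
    if f: "f \<in> Mn k1 k2 k3 n" for f
  proof -
    have "f ((a,b,0),s) = 0" if z: "\<forall>b i. i \<le> t2 - 1 \<longrightarrow> f ((n - i, i, 0), b) = 0" and "b < t2" for a b s
    proof (cases "a + b = n")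
      case True
      then have "a = n - b" by simp
      then show ?thesis using z \<open>b < t2\<close> by auto
    qed (rule Mn_off[OF f])
    then show ?thesis using tval_pos by auto
  qed
  then show "U = {f \<in> V. \<forall>b i. i \<le> t2 - 1 \<longrightarrow> f ((n - i, i, 0), b) = 0}"
    using V unfolding set_eq_iff Int_iff mem_Collect_eq Mnx2_iff[of _] by (elim disjE) (auto simp: Mnx1_iff Mnx2_iff)
qed

text \<open>The mirror window a < t_1, indexed by a. Here Y is lower and X upper bidiagonal, whence
  the twist by (1 2).\<close>

lemma W2_quot:
  assumes V: "V = Mn k1 k2 k3 n \<and> U = Mnx k1 k2 k3 (Suc 0) n \<or> V = Mnx k1 k2 k3 2 n \<and> U = Mnx k1 k2 k3 (Suc 0) n \<inter> Mnx k1 k2 k3 2 n"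
  shows "bi_quot_iso V U (biact k1 k2 k3) (dsum2_car (Cd (t1 - 1)))
     (dsum2 (twist (\<lambda>_. 1) sw12 (Omod (t1 - 1) (of_real k3) (- of_real (k1 + k2 + k3) - of_nat n - 1) (of_real k2))))"
  unfolding Omod_eq
proof (rule quot_iso_from_coefficients[where pt = "\<lambda>i. (i, n - i, 0)"
    and l = "\<lambda>b i. \<i> * sg b * (-1) ^ i * br k2 (n - i + 1)" and r = "\<lambda>b i. - \<i> * sg b * (-1) ^ i * br k1 i"])
  obtain d where d: "t1 = Suc d" using tval_pos gr0_implies_Suc by blast
  have k: "k1 = - real t1 / 2" "k2 = - real t2 / 2" "odd t1" "odd t2" using tval_enat t1 t2 by auto
  have sg2: "sg b * (sg b * x) = x" for b x by (simp add: sg_def)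
  fix b :: bool
  show "\<i> * sg b * (-1) ^ i * br k2 (n - i + 1) \<noteq> 0" if i: "0 < i" "i \<le> t1 - 1" for i
  proof -
    have "n - i + 1 > t2" using i le by linarith
    then have "br k2 (n - i + 1) \<noteq> 0" by (rule br_nonzero_above[OF k(2)])
    then show ?thesis by (simp add: sg_def)
  qed
  show "(\<i> * sg b * (-1) ^ i * br k2 (n - i + 1)) * (- \<i> * sg b * (-1) ^ i * br k1 i)
    = Ophi (t1 - 1) (of_real k3) (- of_real (k1 + k2 + k3) - of_nat n - 1) (of_real k2) i" if i: "0 < i" "i \<le> t1 - 1" for i
  proof -
    have "i \<le> n" using i le by linarith
    then obtain m where m: "n = i + m" using le_Suc_ex by blast
    show ?thesis using k(3) odd unfolding m k(1) d
      by (cases "even i") (simp_all add: Ophi_def br_def sg_def field_simps)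
  qed
next
  fix f j b i assume f: "f \<in> V" and j: "j \<in> {1,2,3::nat}" and i: "i \<le> t1 - 1"
  obtain d where d: "t1 = Suc d" using tval_pos gr0_implies_Suc by blast
  have k: "k1 = - real t1 / 2" "k2 = - real t2 / 2" "odd t1" "odd t2" using tval_enat t1 t2 by auto
  have "i < n" using i le tval_pos by linarith
  then obtain m where m: "n = i + Suc m" using less_iff_Suc_add by auto
  have par: "even i \<longleftrightarrow> even m" "even d" using odd k(3) d by (auto simp: m)
  have ck: "complex_of_real k1 = - (of_nat d + 1) / 2" by (simp add: k(1) d)
  have th: "thetas d (of_real k3) i = (-1) ^ i * (of_nat i + 1 / 2 + of_real k1 + of_real k3)" for i
    by (simp add: thetas_def ck field_simps)
  have ths: "thetas d (- of_real (k1 + k2 + k3) - of_nat n - 1) i = (-1) ^ i * (of_nat i - of_nat n - 1 / 2 - of_real k2 - of_real k3)" for i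
    by (simp add: thetas_def ck field_simps)
  have f0: "dirac k1 k2 k3 f = 0" using V f Mn_dirac by (auto simp: Mnx_def)
  consider "j = 1" | "j = 2" | "j = 3" using j by auto
  then show "biact k1 k2 k3 j f ((i, n - i, 0), b) = 1 * tri (t1 - 1) (thetas (t1 - 1) (of_real k3)) (thetas (t1 - 1) (- of_real (k1 + k2 + k3) - of_nat n - 1))
      (\<lambda>i. \<i> * sg b * (-1) ^ i * br k2 (n - i + 1)) (\<lambda>i. - \<i> * sg b * (-1) ^ i * br k1 i)
      (Ocst (t1 - 1) (of_real k3) (- of_real (k1 + k2 + k3) - of_nat n - 1) (of_real k2)) (sw12 j) (\<lambda>i. f ((i, n - i, 0), b)) i"
  proof cases
    case 1
    show ?thesis unfolding 1 sw12_def tri_def upp_def d diff_Suc_1 ths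
      using i par tval_enat(4)[OF t1]
      by (cases "i = d"; cases "even i") (simp_all add: X_apply[OF f0] d m algebra_simps)
  next
    case 2
    show ?thesis unfolding 2 sw12_def
      by (cases i) (simp_all add: Y_apply[OF f0] d m tri_def low_def th)
  next
    case 3
    show ?thesis unfolding 3 sw12_def tri_def low_def upp_def d diff_Suc_1 th ths
      using i par
      by (cases "i = d"; cases "even i"; cases i)
        (simp_all add: Z_apply d m ck br_def Ocst_def sg_def field_simps)
  qed
next
  fix g :: "bool \<Rightarrow> nat \<Rightarrow> complex"
  obtain f where f: "f \<in> Mn k1 k2 k3 n" "\<And>a b s. f ((a,b,0),s) = (if a + b = n \<and> a \<le> t1 - 1 then g s a else 0)"
    by (rule Mn_extension[OF k3, of "\<lambda>a b s. if a + b = n \<and> a \<le> t1 - 1 then g s a else 0"]) (auto split: if_splits)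
  have "f \<in> V"
    using V f le tval_pos by (auto simp: Mnx2_iff)
  moreover have "f ((i, n - i, 0), b) = g b i" if "i \<le> t1 - 1" for b i
    using that le unfolding f(2) by simp
  ultimately show "\<exists>f\<in>V. \<forall>b i. i \<le> t1 - 1 \<longrightarrow> f ((i, n - i, 0), b) = g b i"
    by blast
next
  have "(\<forall>b i. i \<le> t1 - 1 \<longrightarrow> f ((i, n - i, 0), b) = 0) \<longleftrightarrow> (\<forall>a b s. a < t1 \<longrightarrow> f ((a,b,0), s) = 0)"
    if f: "f \<in> Mn k1 k2 k3 n" for f
  proof -
    have "f ((a,b,0),s) = 0" if z: "\<forall>b i. i \<le> t1 - 1 \<longrightarrow> f ((i, n - i, 0), b) = 0" and "a < t1" for a b s
    proof (cases "a + b = n")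
      case True
      then have "b = n - a" by simp
      then show ?thesis using z \<open>a < t1\<close> by auto
    qed (rule Mn_off[OF f])
    then show ?thesis using tval_pos by auto
  qed
  then show "U = {f \<in> V. \<forall>b i. i \<le> t1 - 1 \<longrightarrow> f ((i, n - i, 0), b) = 0}"
    using V unfolding set_eq_iff Int_iff mem_Collect_eq Mnx2_iff[of _] by (elim disjE) (auto simp: Mnx1_iff Mnx2_iff)
qed

lemma Mn_comb:
  assumes "u \<in> Mn k1 k2 k3 n" "v \<in> Mn k1 k2 k3 n"
  shows "sc c u + v \<in> Mn k1 k2 k3 n"
proof -
  have "dirac k1 k2 k3 (sc c u + v) = 0"
    using Mn_dirac[OF assms(1)] Mn_dirac[OF assms(2)] unfolding dirac_zero_iff
    by (simp add: sc_def ring_distribs mult.left_commute[of _ c] del: mult_minus_left)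
  moreover have "deg \<alpha> = n" if "(sc c u + v) (\<alpha>, s) \<noteq> 0" for \<alpha> s
  proof -
    have "u (\<alpha>, s) \<noteq> 0 \<or> v (\<alpha>, s) \<noteq> 0" using that by (auto simp: sc_def)
    then show ?thesis using assms unfolding Mn_def Pn_def by blast
  qed
  ultimately show ?thesis unfolding Mn_def Pn_def by blast
qed

text \<open>Indexing by i = a - t_1 again makes Y lower bidiagonal. As t_1 is odd, (-1)^a is
  -(-1)^i, which the sign twist absorbs.\<close>

lemma W1_iso:
  "bi_iso (Mnx k1 k2 k3 (Suc 0) n \<inter> Mnx k1 k2 k3 2 n) (biact k1 k2 k3) (dsum2_car (Cd (n - t1 - t2)))
     (dsum2 (twist sgn_mm sw12 (Emod (n - t1 - t2) (of_real k2 + of_real k3 + Ncst n) (- of_real k1 - of_real k3 - Ncst n) (Ncst n))))"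
proof (rule quot_iso_trivial_kernel)
  obtain u1 u2 where u: "t1 = Suc u1" "t2 = Suc u2" using tval_pos gr0_implies_Suc by metis
  obtain d where n: "n = t1 + t2 + d" using le le_Suc_ex by blast
  then have d: "n - t1 - t2 = d" by simp
  have k: "k1 = - real t1 / 2" "k2 = - real t2 / 2" "odd t1" "odd t2" using tval_enat t1 t2 by auto
  have ck: "complex_of_real k1 = - (of_nat u1 + 1) / 2" "complex_of_real k2 = - (of_nat u2 + 1) / 2"
    by (simp_all add: k(1,2) u)
  have par: "odd d" "even u1" "even u2" using odd k by (auto simp: n u)
  let ?V = "Mnx k1 k2 k3 (Suc 0) n \<inter> Mnx k1 k2 k3 2 n"
  let ?a = "of_real k2 + of_real k3 + Ncst n" and ?b = "- of_real k1 - of_real k3 - Ncst n"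
  have th: "thetas d ?a i = (-1) ^ i * (of_nat t1 + of_nat i + 1 / 2 + of_real k1 + of_real k3)" for i
    by (simp add: thetas_def ck u n Ncst_def field_simps)
  have ths: "thetas d ?b i = - ((-1) ^ i * (of_nat n - of_nat t1 - of_nat i + 1 / 2 + of_real k2 + of_real k3))" for i
    by (simp add: thetas_def ck u n Ncst_def field_simps)
  show "bi_quot_iso ?V {0} (biact k1 k2 k3) (dsum2_car (Cd (n - t1 - t2))) (dsum2 (twist sgn_mm sw12 (Emod (n - t1 - t2) ?a ?b (Ncst n))))"
    unfolding d Emod_eq
  proof (rule quot_iso_from_coefficients[where pt = "\<lambda>i. (t1 + i, n - t1 - i, 0)"
    and l = "\<lambda>b i. \<i> * sg b * (-1) ^ i * br k2 (n - t1 - i + 1)" and r = "\<lambda>b i. - \<i> * sg b * (-1) ^ i * br k1 (t1 + i)"])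
    fix b :: bool and i assume i: "0 < i" "i \<le> d"
    then obtain m where m: "d = i + m" using le_Suc_ex by blast
    have "n - t1 - i + 1 > t2" using i n by linarith
    then have "br k2 (n - t1 - i + 1) \<noteq> 0" by (rule br_nonzero_above[OF k(2)])
    then show "\<i> * sg b * (-1) ^ i * br k2 (n - t1 - i + 1) \<noteq> 0" by (simp add: sg_def)
    show "(\<i> * sg b * (-1) ^ i * br k2 (n - t1 - i + 1)) * (- \<i> * sg b * (-1) ^ i * br k1 (t1 + i))
      = Ephi d ?a ?b (Ncst n) i"
      using par by (cases "even i") (simp_all add: n m u Ephi_def br_def sg_def ck Ncst_def field_simps power2_eq_square)
  next
    fix f j b i assume f: "f \<in> ?V" and j: "j \<in> {1,2,3::nat}" and i: "i \<le> d"
    then obtain m where m: "d = i + m" using le_Suc_ex by blast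
    have add3: "x + (y + 3) = Suc (Suc (Suc (x + y)))" for x y :: nat by simp
    have f0: "dirac k1 k2 k3 f = 0" using f Mn_dirac by (auto simp: Mnx_def)
    \<comment> \<open>Unlike in the quotients, both ends of the window are closed by f itself, which
      vanishes at a = t_1 - 1 and b = t_2 - 1.\<close>
    have z1: "f ((u1, b, 0), s) = 0" and z2: "f ((a, u2, 0), s) = 0" for a b s
      using f by (auto simp: Mnx1_iff Mnx2_iff u)
    consider "j = 1" | "j = 2" | "j = 3" using j by auto
    then show "biact k1 k2 k3 j f ((t1 + i, n - t1 - i, 0), b) = sgn_mm (sw12 j) * tri d (thetas d ?a) (thetas d ?b)
      (\<lambda>i. \<i> * sg b * (-1) ^ i * br k2 (n - t1 - i + 1)) (\<lambda>i. - \<i> * sg b * (-1) ^ i * br k1 (t1 + i))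
      (Ecst d ?a ?b (Ncst n)) (sw12 j) (\<lambda>i. f ((t1 + i, n - t1 - i, 0), b)) i"
    proof cases
      case 1
      show ?thesis unfolding 1 sgn_mm_def sw12_def tri_def upp_def ths
        using i par m by (cases m; cases "even i") (simp_all add: X_apply[OF f0] u n z2 algebra_simps)
    next
      case 2
      show ?thesis unfolding 2 sgn_mm_def sw12_def tri_def low_def th
        using i par m by (cases i; cases "even i") (simp_all add: Y_apply[OF f0] u n z1 algebra_simps)
    next
      case 3
      show ?thesis unfolding 3 sgn_mm_def sw12_def tri_def low_def upp_def th ths
        using i par m by (cases m; cases "even i"; cases i)
         (simp_all add: Z_apply u n z1 z2 add3 ck br_def Ecst_def Ncst_def sg_def field_simps power2_eq_square)
    qed
  next
    fix g :: "bool \<Rightarrow> nat \<Rightarrow> complex"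
    obtain f where f: "f \<in> Mn k1 k2 k3 n" "\<And>a b s. f ((a,b,0),s) = (if a + b = n \<and> t1 \<le> a \<and> t2 \<le> b then g s (a - t1) else 0)"
      by (rule Mn_extension[OF k3, of "\<lambda>a b s. if a + b = n \<and> t1 \<le> a \<and> t2 \<le> b then g s (a - t1) else 0"]) (auto split: if_splits)
    have "f \<in> ?V" using f by (auto simp: Mnx1_iff Mnx2_iff)
    moreover have "f ((t1 + i, n - t1 - i, 0), b) = g b i" if "i \<le> d" for b i
    proof -
      have "t1 + i + (n - t1 - i) = n" "t2 \<le> n - t1 - i" using that n by linarith+
      then show ?thesis unfolding f(2) by simp
    qed
    ultimately show "\<exists>f\<in>?V. \<forall>b i. i \<le> d \<longrightarrow> f ((t1 + i, n - t1 - i, 0), b) = g b i" by blast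
  next
    have "f = 0" if f: "f \<in> ?V" and z: "\<And>b i. i \<le> d \<Longrightarrow> f ((t1 + i, n - t1 - i, 0), b) = 0" for f
    proof -
      have f': "f \<in> Mn k1 k2 k3 n" using f by (simp add: Mnx1_iff)
      have "f ((a,b,0),s) = 0" for a b s
      proof (cases "a + b = n \<and> t1 \<le> a \<and> t2 \<le> b")
        case True
        then have "a = t1 + (a - t1)" "b = n - t1 - (a - t1)" "a - t1 \<le> d" using n by auto
        then show ?thesis using z by metis
      next
        case False
        then show ?thesis using f Mn_off[OF f'] by (auto simp: Mnx1_iff Mnx2_iff)
      qed
      then have "f ((a,b,c),s) = 0" for a b c s
        by (rule Mn_vanish[OF f' k3, where Q = "\<lambda>_ _. True"]) auto
      then show ?thesis by (auto simp: fun_eq_iff)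
    qed
    moreover have "0 \<in> Mn k1 k2 k3 n" by (simp add: Mn_def Pn_def dirac_zero_iff)
    then have "0 \<in> ?V" by (simp add: Mnx1_iff Mnx2_iff)
    ultimately show "{0} = {f \<in> ?V. \<forall>b i. i \<le> d \<longrightarrow> f ((t1 + i, n - t1 - i, 0), b) = 0}"
      by auto
  qed
  fix u v c assume "u \<in> ?V" "v \<in> ?V"
  then show "sc c u + v \<in> ?V" using Mn_comb by (auto simp: Mnx1_iff Mnx2_iff sc_def)
qed

end

theorem theorem8p6:
  fixes k1 k2 k3 :: real and n :: nat
  assumes "odd n" and "tval k1 + tval k2 \<le> enat n" and "enat n < tval k3"
  shows "bi_iso (Mnx k1 k2 k3 1 n \<inter> Mnx k1 k2 k3 2 n) (biact k1 k2 k3)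
            (dsum2_car (Cd (n - tnat k1 - tnat k2))) (dsum2 (W1 k1 k2 k3 n))
       \<and> bi_quot_iso (Mnx k1 k2 k3 2 n) (Mnx k1 k2 k3 1 n \<inter> Mnx k1 k2 k3 2 n) (biact k1 k2 k3)
            (dsum2_car (Cd (tnat k1 - 1))) (dsum2 (W2 k1 k2 k3 n))
       \<and> bi_quot_iso (Mn k1 k2 k3 n) (Mnx k1 k2 k3 1 n) (biact k1 k2 k3)
            (dsum2_car (Cd (tnat k1 - 1))) (dsum2 (W2 k1 k2 k3 n))
       \<and> bi_quot_iso (Mnx k1 k2 k3 1 n) (Mnx k1 k2 k3 1 n \<inter> Mnx k1 k2 k3 2 n) (biact k1 k2 k3)
            (dsum2_car (Cd (tnat k2 - 1))) (dsum2 (W3 k1 k2 k3 n))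
       \<and> bi_quot_iso (Mn k1 k2 k3 n) (Mnx k1 k2 k3 2 n) (biact k1 k2 k3)
            (dsum2_car (Cd (tnat k2 - 1))) (dsum2 (W3 k1 k2 k3 n))
       \<and> (k3 \<ge> 0 \<longrightarrow>
            bi_irred (Cd (n - tnat k1 - tnat k2)) (W1 k1 k2 k3 n)
          \<and> bi_irred (Cd (tnat k1 - 1)) (W2 k1 k2 k3 n)
          \<and> bi_irred (Cd (tnat k2 - 1)) (W3 k1 k2 k3 n)
          \<and> bi_iso (Cd (n - tnat k1 - tnat k2)) (W1 k1 k2 k3 n) (Cd (n - tnat k1 - tnat k2))
               (twist sgn_mm id (Emod (n - tnat k1 - tnat k2) (of_real k1 + of_real k3 + Ncst n)
                   (of_real k2 + of_real k3 + Ncst n) (Ncst n)))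
          \<and> bi_iso (Cd (tnat k1 - 1)) (W2 k1 k2 k3 n) (Cd (tnat k1 - 1))
               (Omod (tnat k1 - 1) (- of_real (k1 + k2 + k3) - of_nat n - 1) (of_real k3) (of_real k2)))"
proof -
  obtain t1 t2 where t1: "tval k1 = enat t1" and t2: "tval k2 = enat t2"
    using assms(2) by (cases "tval k1"; cases "tval k2") auto
  have le: "t1 + t2 \<le> n" using assms(2) by (simp add: t1 t2)
  note ctxt = assms(1,3) t1 t2 le
  have tn: "tnat k1 = t1" "tnat k2 = t2" using tval_enat t1 t2 by auto
  have k: "k1 = - real t1 / 2" "k2 = - real t2 / 2" "odd t1" "odd t2" using tval_enat t1 t2 by auto
  have pos: "0 < t1" "0 < t2" using k by (auto intro: odd_pos)
  have W1: "W1 k1 k2 k3 n = twist sgn_mm sw12 (Emod (n - t1 - t2) (of_real k2 + of_real k3 + Ncst n)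
        (- of_real k1 - of_real k3 - Ncst n) (Ncst n))" by (simp add: W1_def tn)
  have W2: "W2 k1 k2 k3 n = twist (\<lambda>_. 1) sw12 (Omod (t1 - 1) (of_real k3) (- of_real (k1 + k2 + k3) - of_nat n - 1) (of_real k2))"
    by (simp add: W2_def tn)
  have W3: "W3 k1 k2 k3 n = Omod (t2 - 1) (of_real k3) (- of_real (k1 + k2 + k3) - of_nat n - 1) (of_real k1)"
    by (simp add: W3_def tn)
  have irred: "bi_irred (Cd (n - t1 - t2)) (W1 k1 k2 k3 n)
          \<and> bi_irred (Cd (t1 - 1)) (W2 k1 k2 k3 n)
          \<and> bi_irred (Cd (t2 - 1)) (W3 k1 k2 k3 n)
          \<and> bi_iso (Cd (n - t1 - t2)) (W1 k1 k2 k3 n) (Cd (n - t1 - t2))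
               (twist sgn_mm id (Emod (n - t1 - t2) (of_real k1 + of_real k3 + Ncst n)
                   (of_real k2 + of_real k3 + Ncst n) (Ncst n)))
          \<and> bi_iso (Cd (t1 - 1)) (W2 k1 k2 k3 n) (Cd (t1 - 1))
               (Omod (t1 - 1) (- of_real (k1 + k2 + k3) - of_nat n - 1) (of_real k3) (of_real k2))"
    if k3: "k3 \<ge> 0"
  proof -
    let ?d = "n - t1 - t2" and ?\<beta> = "- of_real (k1 + k2 + k3) - of_nat n - 1 :: complex"
    have n: "n = ?d + t1 + t2" "odd ?d" using le assms(1) k by auto
    have b: "- of_real k1 - of_real k3 - Ncst n = - (of_real k1 + of_real k3 + Ncst n)" by simp
    note E = E_irred_iso[OF n k(1,2) k3 pos(1)]
    have W1_irred: "bi_irred (Cd ?d) (W1 k1 k2 k3 n)"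
      unfolding W1 b by (rule bi_irred_twist[OF E(1)]) (simp add: sgn_mm_def, rule sw12_image)
    \<comment> \<open>The exchange isomorphism, read backwards and twisted by (-1,-1). These signs
      are symmetric in X and Y, so the two twists on the left combine to that of W_1.\<close>
    have "bi_iso (Cd ?d) (twist sgn_mm id (twist (\<lambda>_. 1) sw12 (Emod ?d (of_real k2 + of_real k3 + Ncst n) (- (of_real k1 + of_real k3 + Ncst n)) (Ncst n))))
      (Cd ?d) (twist sgn_mm id (Emod ?d (of_real k1 + of_real k3 + Ncst n) (of_real k2 + of_real k3 + Ncst n) (Ncst n)))"
      by (intro bi_iso_twist bi_iso_sym[OF E(2)] Cd_sc Cd_zero twist_Cd) (simp_all add: Emod_eq bimat_Cd)
    moreover have "twist sgn_mm id (twist (\<lambda>_. 1) sw12 A) = twist sgn_mm sw12 A"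
      for A :: "nat \<Rightarrow> (nat \<Rightarrow> complex) \<Rightarrow> nat \<Rightarrow> complex"
      by (simp add: twist_def sc_one sgn_mm_sw12)
    ultimately have W1_iso: "bi_iso (Cd ?d) (W1 k1 k2 k3 n) (Cd ?d)
      (twist sgn_mm id (Emod ?d (of_real k1 + of_real k3 + Ncst n) (of_real k2 + of_real k3 + Ncst n) (Ncst n)))"
      unfolding W1 b by simp
    have O2: "bi_irred (Cd (t1 - 1)) (Omod (t1 - 1) ?\<beta> (of_real k3) (of_real k2))"
      "bi_iso (Cd (t1 - 1)) (Omod (t1 - 1) (of_real k3) ?\<beta> (of_real k2)) (Cd (t1 - 1)) (twist (\<lambda>_. 1) sw12 (Omod (t1 - 1) ?\<beta> (of_real k3) (of_real k2)))"
      by (rule O_irred_iso[where t = t1 and t' = t2 and n = n and k = k1]; use pos le k k3 in simp)+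
    have O3: "bi_irred (Cd (t2 - 1)) (Omod (t2 - 1) ?\<beta> (of_real k3) (of_real k1))"
      "bi_iso (Cd (t2 - 1)) (Omod (t2 - 1) (of_real k3) ?\<beta> (of_real k1)) (Cd (t2 - 1)) (twist (\<lambda>_. 1) sw12 (Omod (t2 - 1) ?\<beta> (of_real k3) (of_real k1)))"
      by (rule O_irred_iso[where t = t2 and t' = t1 and n = n and k = k2]; use pos le k k3 in simp)+
    \<comment> \<open>Irreducibility is available with \<beta> as first parameter; W_3 has k_3 first
      and inherits it through the exchange isomorphism.\<close>
    have W3_irred: "bi_irred (Cd (t2 - 1)) (W3 k1 k2 k3 n)"
      unfolding W3 by (rule bi_irred_iso[OF O3(2) bi_irred_twist[OF O3(1)] Cd_zero]) (rule sw12_image | simp)+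
    have W2_irred: "bi_irred (Cd (t1 - 1)) (W2 k1 k2 k3 n)"
      unfolding W2 by (intro bi_irred_twist bi_irred_iso[OF O2(2) bi_irred_twist[OF O2(1)] Cd_zero]) (rule sw12_image | simp)+
    \<comment> \<open>A further twist by (1 2) cancels the one on the target of the exchange
      isomorphism and creates that of W_2 on its source.\<close>
    have "bi_iso (Cd (t1 - 1)) (twist (\<lambda>_. 1) sw12 (Omod (t1 - 1) (of_real k3) ?\<beta> (of_real k2)))
      (Cd (t1 - 1)) (twist (\<lambda>_. 1) sw12 (twist (\<lambda>_. 1) sw12 (Omod (t1 - 1) ?\<beta> (of_real k3) (of_real k2))))"
      by (intro bi_iso_twist[OF O2(2)] Cd_zero) (rule equalityD1[OF sw12_image], simp add: Omod_eq bimat_Cd)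
    moreover have "twist (\<lambda>_. 1) sw12 (twist (\<lambda>_. 1) sw12 A) = A"
      for A :: "nat \<Rightarrow> (nat \<Rightarrow> complex) \<Rightarrow> nat \<Rightarrow> complex"
      by (simp add: twist_def sc_one sw12_sw12)
    ultimately have W2_iso: "bi_iso (Cd (t1 - 1)) (W2 k1 k2 k3 n) (Cd (t1 - 1)) (Omod (t1 - 1) ?\<beta> (of_real k3) (of_real k2))"
      unfolding W2 by simp
    show ?thesis by (intro conjI W1_irred W2_irred W3_irred W1_iso W2_iso)
  qed
  note W1_part = W1_iso[OF ctxt, folded W1]
  note W2_part = W2_quot[OF ctxt, folded W2]
  note W3_part = W3_quot[OF ctxt, unfolded twist_trivial, folded W3]
  note parts = W1_part W2_part[OF disjI1[OF conjI[OF refl refl]]] W2_part[OF disjI2[OF conjI[OF refl refl]]]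
    W3_part[OF disjI1[OF conjI[OF refl refl]]] W3_part[OF disjI2[OF conjI[OF refl refl]]] impI[OF irred]
  show ?thesis
    unfolding tn One_nat_def by (intro conjI parts[unfolded One_nat_def])
qed

end
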